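(* In the setting described in the context, if the matrices $\Omega_1,\ldots,\Omega_m$ are mutually commutative (i.e. $\Omega_\ell\Omega_{\ell'}=\Omega_{\ell'}\Omega_\ell$ for all $1\le\ell,\ell'\le m$), then $$\omega_L=\widetilde\omega_L=\omega_U=\omega=\hat{\boldsymbol\pi}\,C^{-1}\boldsymbol\lambda,$$ and moreover $\omega_L^*=\omega$ whenever $\omega_L^*$ is defined, that is, when the environmental jump chain is cyclic ($\hat X_k=(k\bmod m)+1$ for all $k\ge 0$).
   Context: Setting. Let $\{X(t):t\ge0\}$ (the random environment) be an irreducible continuous-time Markov chain on $\{1,\ldots,m\}$ with generator $Q$; put $c_\ell=|Q_{\ell\ell}|>0$ and $C=\mathrm{diag}(c_1,\ldots,c_m)$. Let $\{\hat X_k:k\ge0\}$ be its jump chain, with transition matrix $\hat P=I+C^{-1}Q$ and stationary probability (row) vector $\hat{\boldsymbol\pi}$, and let $\{\xi_k:k\ge0\}$ be the successive sojourn times (given the jump chain, the $\xi_k$ are independent and $\xi_k$ is exponential with parameter $c_{\hat X_k}$). Put $\widetilde P=\mathrm{diag}(\hat{\boldsymbol\pi})^{-1}\hat P^T\mathrm{diag}(\hat{\boldsymbol\pi})$. For each $\ell\in\{1,\ldots,m\}$, $\Omega_\ell$ is a real irreducible $r\times r$ matrix with nonnegative off-diagonal entries ($r$ is the number of types of the branching process). Write $\hat\Omega_k=\Omega_{\hat X_k}$. Let $\lambda_\ell$ be the eigenvalue of $\Omega_\ell$ of maximal real part (it is real), and $\boldsymbol\lambda=(\lambda_1,\ldots,\lambda_m)^\top$.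 Let $\boldsymbol u_\ell$ (row) and $\boldsymbol v_\ell=(v_{\ell,1},\ldots,v_{\ell,r})^\top$ be the strictly positive left and right eigenvectors of $\Omega_\ell$ for $\lambda_\ell$, normalised by $\boldsymbol u_\ell\boldsymbol 1=1$, $\boldsymbol u_\ell\boldsymbol v_\ell=1$. Put $\Omega_\ell^*=\Omega_\ell-\lambda_\ell I$, $\Delta_\ell=\mathrm{diag}(\boldsymbol v_\ell)$, $\Delta'_\ell=\mathrm{diag}(\boldsymbol u_\ell)$, $\Theta_\ell=\Delta_\ell^{-1}\Omega_\ell^*\Delta_\ell$, $\Theta'_\ell=(\Delta'_\ell)^{-1}(\Omega_\ell^* )^T\Delta'_\ell$, $M_\ell=c_\ell[(c_\ell+\lambda_\ell)I-\Omega_\ell]^{-1}$, $N_\ell=c_\ell(c_\ell I-\Theta_\ell)^{-1}$, $\widetilde N_\ell=c_\ell(c_\ell I-\Theta'_\ell)^{-1}$, and let $M,N,\widetilde N$ be the block-diagonal matrices of order $rm$ with diagonal blocks $M_\ell,N_\ell,\widetilde N_\ell$, $1\le \ell\le m$. Growth rate: $\omega=\lim_{n\to\infty}\frac1n\log\{e^{\hat\Omega_0\xi_0}e^{\hat\Omega_1\xi_1}\cdots e^{\hat\Omega_{n-1}\xi_{n-1}}\}_{ij}$ a.s., which is known to exist almost surely and to be a constant not depending on $i,j$. Bounds (with $\mathrm{sp}$ the spectral radius, $\otimes$ the Kronecker product, logarithms of vectors entrywise): $\omega_U=\hat{\boldsymbol\pi}C^{-1}\boldsymbol\lambda+\log\mathrm{sp}[M(\hat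 P\otimes I_r)]$; $\omega_L=\hat{\boldsymbol\pi}C^{-1}\boldsymbol\lambda+\boldsymbol\pi^{(1)}(I-N)\log\bar{\boldsymbol v}$, with $\boldsymbol\pi^{(1)}$ the stationary probability vector of $N(\hat P\otimes I_r)$ and $\bar{\boldsymbol v}$ the column vector stacking $\boldsymbol v_1,\ldots,\boldsymbol v_m$; $\widetilde\omega_L=\hat{\boldsymbol\pi}C^{-1}\boldsymbol\lambda+\widetilde{\boldsymbol\pi}^{(1)}(I-\widetilde N)\log\bar{\boldsymbol u}^T$, with $\widetilde{\boldsymbol\pi}^{(1)}$ the stationary probability vector of $\widetilde N(\widetilde P\otimes I_r)$ and $\bar{\boldsymbol u}=[\boldsymbol u_1\cdots\boldsymbol u_m]$; when the jump chain is cyclic, $\hat X_k=(k\bmod m)+1$, $$\omega_L^*=\hat{\boldsymbol\pi}C^{-1}\boldsymbol\lambda+\frac1m\sum_{1\le i,j\le r}\alpha_i(N_1\cdots N_m)_{ij}\,\mathbb E\big[\log\mathbb E[R_0\mid\varphi_0=i,\varphi_m=j,\boldsymbol\zeta^*]\big],$$ where $\boldsymbol\alpha N_1\cdots N_m=\boldsymbol\alpha$, $\boldsymbol\alpha\boldsymbol1=1$; $\boldsymbol\zeta^*=(\xi^*_1,\ldots,\xi^*_m)$ has independent components, $\xi^*_\ell$ being exponential with parameter $c_\ell$; given $\boldsymbol\zeta^*$, $\varphi_0,\ldots,\varphi_m$ is a Markov chain on $\{1,\ldots,r\}$ with transition matrix $e^{\Theta_\ell\xi_\ell^*}$ from $\varphi_{\ell-1}$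 to $\varphi_\ell$; and $R_0=\dfrac{v_{1,\varphi_0}v_{2,\varphi_1}\cdots v_{m,\varphi_{m-1}}}{v_{m,\varphi_0}v_{1,\varphi_1}\cdots v_{m-1,\varphi_{m-1}}}$. The outer expectation is with respect to $\boldsymbol\zeta^*$. *)

theory Defs
  imports "HOL-Probability.Probability"
begin

section \<open>Matrix notions\<close>

text \<open>Irreducibility is strong connectedness of the digraph of nonzero entries; in particular
  every \<open>1 \<times> 1\<close> matrix is irreducible.\<close>

definition irreducible_matrix :: "real^'n^'n \<Rightarrow> bool" where
  "irreducible_matrix A \<longleftrightarrow> (\<forall>i j. (i, j) \<in> {(a, b). A $ a $ b \<noteq> 0}\<^sup>*)"

definition is_eigenvalue :: "real^'n^'n \<Rightarrow> complex \<Rightarrow> bool" where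
  "is_eigenvalue A \<mu> \<longleftrightarrow> (\<exists>z. z \<noteq> 0 \<and> map_matrix complex_of_real A *v z = \<mu> *s z)"

definition dominant_eigenvalue :: "real^'n^'n \<Rightarrow> real \<Rightarrow> bool" where
  "dominant_eigenvalue A l \<longleftrightarrow>
     is_eigenvalue A (complex_of_real l) \<and> (\<forall>\<mu>. is_eigenvalue A \<mu> \<longrightarrow> Re \<mu> \<le> l)"

definition spectral_radius :: "real^'n^'n \<Rightarrow> real" where
  "spectral_radius A = Sup (cmod ` {\<mu>. is_eigenvalue A \<mu>})"

definition diag_matrix :: "real^'n \<Rightarrow> real^'n^'n" where
  "diag_matrix d = (\<chi> i j. if i = j then d $ i else 0)"

definition mat_exp :: "real^'n^'n \<Rightarrow> real^'n^'n" where
  "mat_exp A = (\<Sum>n. (1 / fact n) *\<^sub>R (((**) A) ^^ n) (mat 1))"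

text \<open>\<open>mat_prod A n = A 0 ** A 1 ** \<dots> ** A (n - 1)\<close>, in this order.\<close>

primrec mat_prod :: "(nat \<Rightarrow> real^'n^'n) \<Rightarrow> nat \<Rightarrow> real^'n^'n" where
  "mat_prod A 0 = mat 1"
| "mat_prod A (Suc n) = mat_prod A n ** A n"

text \<open>Matrices and vectors of order \<open>r m\<close> are indexed by pairs (environment state, type).\<close>

definition kronecker :: "real^'m^'m \<Rightarrow> real^'r^'r \<Rightarrow> real^('m \<times> 'r)^('m \<times> 'r)"
    (infixl "\<otimes>\<^sub>K" 75) where
  "A \<otimes>\<^sub>K B = (\<chi> a b. A $ fst a $ fst b * B $ snd a $ snd b)"

definition block_diag :: "('m::finite \<Rightarrow> real^'r^'r) \<Rightarrow> real^('m \<times> 'r)^('m \<times> 'r)" where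
  "block_diag B = (\<chi> a b. if fst a = fst b then B (fst a) $ snd a $ snd b else 0)"

definition stack :: "('m::finite \<Rightarrow> real^'r) \<Rightarrow> real^('m \<times> 'r)" where
  "stack w = (\<chi> a. w (fst a) $ snd a)"

definition ln_vec :: "real^'n \<Rightarrow> real^'n" where
  "ln_vec w = (\<chi> i. ln (w $ i))"

definition stationary_distribution :: "real^'n^'n \<Rightarrow> real^'n \<Rightarrow> bool" where
  "stationary_distribution A p \<longleftrightarrow> (\<forall>i. 0 \<le> p $ i) \<and> (\<Sum>i\<in>UNIV. p $ i) = 1 \<and> p v* A = p"


section \<open>The random environment\<close>

definition rates :: "real^'m^'m \<Rightarrow> real^'m" where
  "rates Q = (\<chi> l. \<bar>Q $ l $ l\<bar>)"

definition rate_matrix :: "real^'m^'m \<Rightarrow> real^'m^'m" where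
  "rate_matrix Q = diag_matrix (rates Q)"

definition jump_matrix :: "real^'m^'m \<Rightarrow> real^'m^'m" where
  "jump_matrix Q = mat 1 + matrix_inv (rate_matrix Q) ** Q"

definition reversed_jump_matrix :: "real^'m^'m \<Rightarrow> real^'m \<Rightarrow> real^'m^'m" where
  "reversed_jump_matrix Q p =
     matrix_inv (diag_matrix p) ** transpose (jump_matrix Q) ** diag_matrix p"

definition exponential_measure :: "real \<Rightarrow> real measure" where
  "exponential_measure c = density lborel (exponential_density c)"

text \<open>Jump times, jump chain and sojourn times of a path \<open>w\<close> (time runs over \<open>t \<ge> 0\<close>).\<close>

primrec jump_time :: "(real \<Rightarrow> 's) \<Rightarrow> nat \<Rightarrow> real" where
  "jump_time w 0 = 0"
| "jump_time w (Suc k) = Inf {t. t > jump_time w k \<and> w t \<noteq> w (jump_time w k)}"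

definition jump_chain :: "(real \<Rightarrow> 's) \<Rightarrow> nat \<Rightarrow> 's" where
  "jump_chain w k = w (jump_time w k)"

definition sojourn :: "(real \<Rightarrow> 's) \<Rightarrow> nat \<Rightarrow> real" where
  "sojourn w k = jump_time w (Suc k) - jump_time w k"

text \<open>An irreducible continuous-time Markov chain with generator \<open>Q\<close> and arbitrary initial
  distribution, in the jump chain / holding time formulation: the paths are right-continuous step
  functions, the jump chain is Markov with transition matrix \<open>jump_matrix Q\<close>, and given the jump
  chain the sojourn times are independent, the \<open>k\<close>-th one being exponential with the rate of the
  \<open>k\<close>-th visited state. Conditioning on \<open>Y 0, \<dots>, Y n\<close> for every \<open>n\<close> amounts to
  conditioning on the whole chain, since \<open>B k\<close> may be \<open>UNIV\<close>.\<close>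

locale irreducible_ctmc = prob_space Pr
  for Pr :: "'a measure" and X :: "real \<Rightarrow> 'a \<Rightarrow> 'm::finite" and Q :: "real^'m^'m" +
  fixes Y :: "nat \<Rightarrow> 'a \<Rightarrow> 'm" and S :: "nat \<Rightarrow> 'a \<Rightarrow> real"
  defines "Y \<equiv> \<lambda>k x. jump_chain (\<lambda>t. X t x) k"
    and "S \<equiv> \<lambda>k x. sojourn (\<lambda>t. X t x) k"
  assumes Q_nonneg: "\<And>i j. i \<noteq> j \<Longrightarrow> 0 \<le> Q $ i $ j"
    and Q_row_sum: "\<And>i. (\<Sum>j\<in>UNIV. Q $ i $ j) = 0"
    and Q_irreducible: "irreducible_matrix Q"
    and rates_pos: "\<And>l. 0 < rates Q $ l"
    and X_measurable: "\<And>t. 0 \<le> t \<Longrightarrow> X t \<in> measurable Pr (count_space UNIV)"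
    and X_right_continuous:
      "\<And>x t. x \<in> space Pr \<Longrightarrow> 0 \<le> t \<Longrightarrow> \<exists>\<epsilon>>0. \<forall>s\<in>{t..<t + \<epsilon>}. X s x = X t x"
    and Y_measurable: "\<And>k. Y k \<in> measurable Pr (count_space UNIV)"
    and S_measurable: "\<And>k. S k \<in> borel_measurable Pr"
    and jump_chain_law:
      "\<And>n y. prob {x \<in> space Pr. \<forall>k\<le>n. Y k x = y k} =
         prob {x \<in> space Pr. Y 0 x = y 0} * (\<Prod>k<n. jump_matrix Q $ y k $ y (Suc k))"
    and sojourn_law:
      "\<And>n y B. (\<And>k. B k \<in> sets borel) \<Longrightarrow>
         prob {x \<in> space Pr. \<forall>k\<le>n. Y k x = y k \<and> S k x \<in> B k} =
         prob {x \<in> space Pr. \<forall>k\<le>n. Y k x = y k} *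
           (\<Prod>k\<le>n. measure (exponential_measure (rates Q $ y k)) (B k))"


section \<open>Growth rate\<close>

definition is_growth_rate ::
  "'a measure \<Rightarrow> (real \<Rightarrow> 'a \<Rightarrow> 'm) \<Rightarrow> ('m \<Rightarrow> real^'r^'r) \<Rightarrow> real \<Rightarrow> bool" where
  "is_growth_rate Pr X \<Omega> w \<longleftrightarrow>
     (AE x in Pr. \<forall>i j.
        (\<lambda>n. 1 / real n *
           ln (mat_prod (\<lambda>k. mat_exp (sojourn (\<lambda>t. X t x) k *\<^sub>R \<Omega> (jump_chain (\<lambda>t. X t x) k))) n
                 $ i $ j)) \<longlonglongrightarrow> w)"


section \<open>Bounds\<close>

definition mean_drift :: "real^'m^'m \<Rightarrow> real^'m \<Rightarrow> real^'m \<Rightarrow> real" where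
  "mean_drift Q p lam = p \<bullet> (matrix_inv (rate_matrix Q) *v lam)"

definition Omega_star :: "('m \<Rightarrow> real^'r^'r) \<Rightarrow> real^'m \<Rightarrow> 'm \<Rightarrow> real^'r^'r" where
  "Omega_star \<Omega> lam l = \<Omega> l - lam $ l *\<^sub>R mat 1"

definition Theta ::
  "('m \<Rightarrow> real^'r^'r) \<Rightarrow> real^'m \<Rightarrow> ('m \<Rightarrow> real^'r) \<Rightarrow> 'm \<Rightarrow> real^'r^'r" where
  "Theta \<Omega> lam v l =
     matrix_inv (diag_matrix (v l)) ** Omega_star \<Omega> lam l ** diag_matrix (v l)"

definition Theta' ::
  "('m \<Rightarrow> real^'r^'r) \<Rightarrow> real^'m \<Rightarrow> ('m \<Rightarrow> real^'r) \<Rightarrow> 'm \<Rightarrow> real^'r^'r" where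
  "Theta' \<Omega> lam u l =
     matrix_inv (diag_matrix (u l)) ** transpose (Omega_star \<Omega> lam l) ** diag_matrix (u l)"

definition M_block ::
  "real^'m^'m \<Rightarrow> ('m \<Rightarrow> real^'r^'r) \<Rightarrow> real^'m \<Rightarrow> 'm \<Rightarrow> real^'r^'r" where
  "M_block Q \<Omega> lam l =
     rates Q $ l *\<^sub>R matrix_inv ((rates Q $ l + lam $ l) *\<^sub>R mat 1 - \<Omega> l)"

definition N_block ::
  "real^'m^'m \<Rightarrow> ('m \<Rightarrow> real^'r^'r) \<Rightarrow> real^'m \<Rightarrow> ('m \<Rightarrow> real^'r) \<Rightarrow> 'm \<Rightarrow> real^'r^'r"
  where
  "N_block Q \<Omega> lam v l =
     rates Q $ l *\<^sub>R matrix_inv (rates Q $ l *\<^sub>R mat 1 - Theta \<Omega> lam v l)"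

definition N'_block ::
  "real^'m^'m \<Rightarrow> ('m \<Rightarrow> real^'r^'r) \<Rightarrow> real^'m \<Rightarrow> ('m \<Rightarrow> real^'r) \<Rightarrow> 'm \<Rightarrow> real^'r^'r"
  where
  "N'_block Q \<Omega> lam u l =
     rates Q $ l *\<^sub>R matrix_inv (rates Q $ l *\<^sub>R mat 1 - Theta' \<Omega> lam u l)"

definition omega_U ::
  "real^'m^'m \<Rightarrow> ('m \<Rightarrow> real^'r^'r) \<Rightarrow> real^'m \<Rightarrow> real^'m \<Rightarrow> real" where
  "omega_U Q \<Omega> p lam =
     mean_drift Q p lam +
     ln (spectral_radius (block_diag (M_block Q \<Omega> lam) ** (jump_matrix Q \<otimes>\<^sub>K mat 1)))"

text \<open>In the next two definitions \<open>p1\<close> is the stationary distribution of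
  \<open>block_diag (N_block \<dots>) ** (jump_matrix Q \<otimes>\<^sub>K mat 1)\<close>, respectively of
  \<open>block_diag (N'_block \<dots>) ** (reversed_jump_matrix Q p \<otimes>\<^sub>K mat 1)\<close>.\<close>

definition omega_L ::
  "real^'m^'m \<Rightarrow> ('m \<Rightarrow> real^'r^'r) \<Rightarrow> real^'m \<Rightarrow> real^'m \<Rightarrow> ('m \<Rightarrow> real^'r) \<Rightarrow>
   real^('m \<times> 'r) \<Rightarrow> real" where
  "omega_L Q \<Omega> p lam v p1 =
     mean_drift Q p lam +
     p1 \<bullet> ((mat 1 - block_diag (N_block Q \<Omega> lam v)) *v ln_vec (stack v))"

definition omega_L' ::
  "real^'m^'m \<Rightarrow> ('m \<Rightarrow> real^'r^'r) \<Rightarrow> real^'m \<Rightarrow> real^'m \<Rightarrow> ('m \<Rightarrow> real^'r) \<Rightarrow>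
   real^('m \<times> 'r) \<Rightarrow> real" where
  "omega_L' Q \<Omega> p lam u p1 =
     mean_drift Q p lam +
     p1 \<bullet> ((mat 1 - block_diag (N'_block Q \<Omega> lam u)) *v ln_vec (stack u))"


section \<open>The bound for a cyclic environment\<close>

text \<open>In this section \<open>st\<close> is the enumeration \<open>st 1, \<dots>, st m\<close> of the environment states.

  \<open>chain_pmf A i n\<close> is the law of the Markov chain \<open>\<phi> 0 = i, \<phi> 1, \<dots>, \<phi> n\<close> whose transition
  matrix from \<open>\<phi> (l - 1)\<close> to \<open>\<phi> l\<close> is the stochastic matrix \<open>A l\<close>; the values of \<open>\<phi>\<close> beyond
  \<open>n\<close> are dummies.\<close>

definition row_pmf :: "real^'r^'r \<Rightarrow> 'r \<Rightarrow> 'r pmf" where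
  "row_pmf A i = embed_pmf (\<lambda>j. A $ i $ j)"

primrec chain_pmf :: "(nat \<Rightarrow> real^'r^'r) \<Rightarrow> 'r \<Rightarrow> nat \<Rightarrow> (nat \<Rightarrow> 'r) pmf" where
  "chain_pmf A i 0 = return_pmf (\<lambda>_. i)"
| "chain_pmf A i (Suc n) =
     bind_pmf (chain_pmf A i n)
       (\<lambda>\<phi>. map_pmf (\<lambda>j. \<phi>(Suc n := j)) (row_pmf (A (Suc n)) (\<phi> n)))"

definition R0 :: "(nat \<Rightarrow> 'm) \<Rightarrow> nat \<Rightarrow> ('m \<Rightarrow> real^'r) \<Rightarrow> (nat \<Rightarrow> 'r) \<Rightarrow> real" where
  "R0 st m v \<phi> =
     (\<Prod>l=1..m. v (st l) $ \<phi> (l - 1)) /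
     (v (st m) $ \<phi> 0 * (\<Prod>l=1..m - 1. v (st l) $ \<phi> l))"

text \<open>The conditional expectation of \<open>R0\<close> given \<open>\<phi> 0 = i\<close>, \<open>\<phi> m = j\<close> and the sojourn times
  \<open>z 1, \<dots>, z m\<close>. The transition matrices \<open>mat_exp (z l *\<^sub>R Theta \<dots>)\<close> are stochastic and, for
  positive \<open>z l\<close>, have positive entries, so the conditioning event has positive probability.\<close>

definition cond_exp_R0 ::
  "(nat \<Rightarrow> 'm) \<Rightarrow> ('m::finite \<Rightarrow> real^'r^'r) \<Rightarrow> real^'m \<Rightarrow> ('m \<Rightarrow> real^'r) \<Rightarrow> 'r \<Rightarrow> 'r \<Rightarrow>
   (nat \<Rightarrow> real) \<Rightarrow> real" where
  "cond_exp_R0 st \<Omega> lam v i j z =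
     measure_pmf.expectation
       (cond_pmf (chain_pmf (\<lambda>l. mat_exp (z l *\<^sub>R Theta \<Omega> lam v (st l))) i CARD('m))
          {\<phi>. \<phi> CARD('m) = j})
       (R0 st CARD('m) v)"

definition N_prod ::
  "(nat \<Rightarrow> 'm) \<Rightarrow> real^'m^'m \<Rightarrow> ('m::finite \<Rightarrow> real^'r^'r) \<Rightarrow> real^'m \<Rightarrow> ('m \<Rightarrow> real^'r) \<Rightarrow>
   real^'r^'r" where
  "N_prod st Q \<Omega> lam v = mat_prod (\<lambda>k. N_block Q \<Omega> lam v (st (Suc k))) CARD('m)"

definition omega_L_star ::
  "(nat \<Rightarrow> 'm) \<Rightarrow> real^'m^'m \<Rightarrow> ('m::finite \<Rightarrow> real^'r^'r) \<Rightarrow> real^'m \<Rightarrow> real^'m \<Rightarrow>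
   ('m \<Rightarrow> real^'r) \<Rightarrow> real^'r \<Rightarrow> real" where
  "omega_L_star st Q \<Omega> p lam v \<alpha> =
     mean_drift Q p lam +
     1 / real CARD('m) *
       (\<Sum>i\<in>UNIV. \<Sum>j\<in>UNIV. \<alpha> $ i * N_prod st Q \<Omega> lam v $ i $ j *
          (LINT z | PiM {1..CARD('m)} (\<lambda>l. exponential_measure (rates Q $ st l)).
             ln (cond_exp_R0 st \<Omega> lam v i j z)))"

end

theory Submission
  imports Defs
begin

text \<open>Commuting irreducible matrices with nonnegative off-diagonal entries have the same Perron
  eigenvectors, because Perron eigenspaces are one-dimensional; so all \<open>u l\<close> agree and all \<open>v l\<close>
  agree. The correction terms of the bounds then vanish: \<open>1 \<otimes> ln v\<close> and \<open>1 \<otimes> ln u\<close> are fixed by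
  the environment factor of the stationary chains, \<open>1 \<otimes> v\<close> is a positive eigenvector of the matrix
  in \<open>omega_U\<close> for the eigenvalue \<open>1\<close>, and \<open>R0\<close> telescopes to \<open>1\<close>.

  For the growth rate, the matrix products have the common eigenvector \<open>v\<close> with eigenvalue the
  exponential of the sum of the \<open>lam\<close>-weighted sojourn times. Since the limit is assumed to exist and
  to be constant, no ergodic theorem is needed: the averages of these sums are bounded in
  \<open>L\<^sup>2\<close>, so the limit is the limit of their expectations, which the Poisson equation
  of the jump chain computes.\<close>

section \<open>Perron eigenvectors of commuting matrices\<close>

text \<open>Induction along a path of nonzero entries that starts at \<open>i\<close>. A loop cannot
  leave \<open>Z\<close>, so closure is only asked of off-diagonal entries.\<close>

lemma irreducible_matrix_closed_UNIV:
  assumes A: "irreducible_matrix A" and i: "i \<in> Z"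
    and closed: "\<And>i j. i \<in> Z \<Longrightarrow> i \<noteq> j \<Longrightarrow> A $ i $ j \<noteq> 0 \<Longrightarrow> j \<in> Z"
  shows "Z = UNIV"
proof -
  have "j \<in> Z" for j
  proof -
    have "(i, j) \<in> {(a, b). A $ a $ b \<noteq> 0}\<^sup>*"
      using A by (simp add: irreducible_matrix_def)
    then show ?thesis
    proof (induction rule: rtrancl_induct)
      case (step y z)
      then show ?case using closed[of y z] by (cases "y = z") auto
    qed (rule i)
  qed
  then show ?thesis by auto
qed

lemma irreducible_matrix_transpose:
  assumes "irreducible_matrix A"
  shows "irreducible_matrix (transpose A)"
proof -
  have "{(a, b). transpose A $ a $ b \<noteq> 0} = {(a, b). A $ a $ b \<noteq> 0}\<inverse>"
    by (auto simp: transpose_def)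
  then show ?thesis
    using assms by (auto simp: irreducible_matrix_def rtrancl_converse)
qed

lemma finite_argmin:
  fixes f :: "'n::finite \<Rightarrow> real"
  obtains i where "\<And>j. f i \<le> f j"
proof -
  have "Min (range f) \<in> range f" by (rule Min_in) auto
  then obtain i where "f i = Min (range f)" by (metis imageE)
  then show thesis
    using that by (metis Min_le finite finite_imageI rangeI)
qed

text \<open>The scalar \<open>t\<close> is the smallest ratio \<open>x $ i / v $ i\<close>, attained
  where the shifted vector touches zero. Both the uniqueness of Perron vectors and the minimum
  principle for M-matrices start here.\<close>

lemma ratio_minimum_shift:
  fixes v x :: "real^'n"
  assumes v: "\<And>i. 0 < v $ i"
  shows "\<exists>t i. (x - t *\<^sub>R v) $ i = 0 \<and> (\<forall>j. 0 \<le> (x - t *\<^sub>R v) $ j)"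
proof -
  obtain i where i: "\<And>j. x $ i / v $ i \<le> x $ j / v $ j"
    using finite_argmin[of "\<lambda>j. x $ j / v $ j"] by blast
  have "0 \<le> (x - (x $ i / v $ i) *\<^sub>R v) $ j" for j
    using mult_right_mono[OF i[of j], of "v $ j"] v[of j] by (simp add: less_imp_le)
  moreover have "(x - (x $ i / v $ i) *\<^sub>R v) $ i = 0"
    using v[of i] by simp
  ultimately show ?thesis by blast
qed

text \<open>The shifted vector \<open>y\<close> is nonnegative, has a zero entry and solves the same
  equation. At a zero of \<open>y\<close> a sum of nonnegative terms vanishes, so zeros spread along
  nonzero entries of \<open>A\<close>, and irreducibility gives \<open>y = 0\<close>.\<close>

lemma Perron_eigenspace:
  fixes A :: "real^'n^'n"
  assumes nonneg: "\<And>i j. i \<noteq> j \<Longrightarrow> 0 \<le> A $ i $ j" and irr: "irreducible_matrix A"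
    and v: "\<And>i. 0 < v $ i" "A *v v = l *\<^sub>R v" and x: "A *v x = l *\<^sub>R x"
  shows "\<exists>t. x = t *\<^sub>R v"
proof -
  obtain t i where i: "(x - t *\<^sub>R v) $ i = 0" and pos: "\<And>j. 0 \<le> (x - t *\<^sub>R v) $ j"
    using ratio_minimum_shift[OF v(1), of x] by blast
  define y where "y = x - t *\<^sub>R v"
  have y: "A *v y = l *\<^sub>R y"
    by (simp add: y_def v x matrix_vector_mult_diff_distrib matrix_vector_mult_scaleR
        scaleR_diff_right)
  have "{i. y $ i = 0} = UNIV"
  proof (rule irreducible_matrix_closed_UNIV[OF irr])
    show "i \<in> {i. y $ i = 0}" using i by (simp add: y_def)
    fix a b assume a: "a \<in> {i. y $ i = 0}" and ab: "a \<noteq> b" "A $ a $ b \<noteq> 0"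
    have "(\<Sum>j\<in>UNIV. A $ a $ j * y $ j) = 0"
      using arg_cong[OF y, of "\<lambda>z. z $ a"] a by (simp add: matrix_vector_mult_def)
    \<comment> \<open>A diagonal entry of \<open>A\<close> may be negative, but it is multiplied by
      \<open>y $ a = 0\<close>.\<close>
    moreover have "0 \<le> A $ a $ j * y $ j" for j
      using a nonneg[of a j] pos[of j] by (cases "a = j") (auto simp: y_def)
    ultimately have "A $ a $ b * y $ b = 0"
      by (simp add: sum_nonneg_eq_0_iff)
    then show "b \<in> {i. y $ i = 0}" using ab by simp
  qed
  then have "y = 0" by (auto simp: vec_eq_iff)
  then show ?thesis by (auto simp: y_def)
qed

text \<open>The line spanned by \<open>v\<close> is an eigenspace of \<open>A\<close>, hence
  invariant under the commuting \<open>B\<close>; so \<open>v\<close> is an eigenvector of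
  \<open>B\<close>. Pairing with the positive left eigenvector \<open>u\<close> identifies its
  eigenvalue as \<open>b\<close>, and one-dimensionality applies to \<open>B\<close>.\<close>

lemma commuting_Perron_eigenvectors:
  fixes A B :: "real^'n^'n"
  assumes A: "\<And>i j. i \<noteq> j \<Longrightarrow> 0 \<le> A $ i $ j" "irreducible_matrix A"
    and B: "\<And>i j. i \<noteq> j \<Longrightarrow> 0 \<le> B $ i $ j" "irreducible_matrix B"
    and comm: "A ** B = B ** A"
    and v: "\<And>i. 0 < v $ i" "A *v v = a *\<^sub>R v"
    and w: "\<And>i. 0 < w $ i" "B *v w = b *\<^sub>R w"
    and u: "\<And>i. 0 < u $ i" "u v* B = b *\<^sub>R u"
  shows "\<exists>t. v = t *\<^sub>R w"
proof -
  have "A *v (B *v v) = a *\<^sub>R (B *v v)"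
    by (metis comm matrix_vector_mul_assoc matrix_vector_mult_scaleR v(2))
  then obtain c where c: "B *v v = c *\<^sub>R v"
    using Perron_eigenspace[OF A v] by blast
  have "(u v* B) \<bullet> v = u \<bullet> (B *v v)" by (rule dot_lmul_matrix)
  then have "b * (u \<bullet> v) = c * (u \<bullet> v)" by (simp add: c u)
  moreover have "0 < u \<bullet> v"
    unfolding inner_vec_def by (intro sum_pos) (simp_all add: u v)
  ultimately have "B *v v = b *\<^sub>R v" using c by simp
  then show ?thesis using Perron_eigenspace[OF B w] by blast
qed

text \<open>Left eigenvectors are treated as right eigenvectors of the transposes, where
  \<open>v l'\<close> becomes the positive left eigenvector. The normalisations fix the scalar
  factors; the one for \<open>v\<close> involves \<open>u\<close>, so \<open>u\<close> comes
  first.\<close>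

lemma common_Perron_eigenvectors:
  fixes \<Omega> :: "'m \<Rightarrow> real^'r^'r"
  assumes nonneg: "\<And>l i j. i \<noteq> j \<Longrightarrow> 0 \<le> \<Omega> l $ i $ j"
    and irr: "\<And>l. irreducible_matrix (\<Omega> l)"
    and u: "\<And>l i. 0 < u l $ i" "\<And>l. u l v* \<Omega> l = lam l *\<^sub>R u l"
    and v: "\<And>l i. 0 < v l $ i" "\<And>l. \<Omega> l *v v l = lam l *\<^sub>R v l"
    and norm: "\<And>l. (\<Sum>i\<in>UNIV. u l $ i) = 1" "\<And>l. u l \<bullet> v l = 1"
    and comm: "\<And>l l'. \<Omega> l ** \<Omega> l' = \<Omega> l' ** \<Omega> l"
  shows "u l = u l'" "v l = v l'"
proof -
  have "\<exists>t. u l = t *\<^sub>R u l'"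
  proof (rule commuting_Perron_eigenvectors)
    show "transpose (\<Omega> l) ** transpose (\<Omega> l') = transpose (\<Omega> l') ** transpose (\<Omega> l)"
      by (metis comm matrix_transpose_mul)
    show "v l' v* transpose (\<Omega> l') = lam l' *\<^sub>R v l'" by (simp add: v)
    show "transpose (\<Omega> l) *v u l = lam l *\<^sub>R u l" "transpose (\<Omega> l') *v u l' = lam l' *\<^sub>R u l'"
      by (simp_all add: u)
    show "0 \<le> transpose (\<Omega> l) $ i $ j" "0 \<le> transpose (\<Omega> l') $ i $ j" if "i \<noteq> j" for i j
      using that nonneg by (simp_all add: transpose_def)
  qed (fact u v irreducible_matrix_transpose[OF irr])+
  then obtain t where t: "u l = t *\<^sub>R u l'" by blast
  then have "t = 1"
    using norm(1)[of l] by (simp add: sum_distrib_left[symmetric] norm)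
  with t show uu: "u l = u l'" by simp
  have "\<exists>t. v l = t *\<^sub>R v l'"
    by (rule commuting_Perron_eigenvectors[OF nonneg irr nonneg irr comm v v u])
  then obtain s where s: "v l = s *\<^sub>R v l'" by blast
  then have "s = 1" using norm(2)[of l] by (simp add: uu norm)
  with s show "v l = v l'" by simp
qed

section \<open>Inverses of M-matrices and the spectral radius\<close>

lemma matrix_inv_mult:
  fixes A :: "'a::field^'n^'n"
  assumes "invertible A"
  shows "A ** matrix_inv A = mat 1" "matrix_inv A ** A = mat 1"
  using someI_ex[OF assms[unfolded invertible_def]] by (simp_all add: matrix_inv_def)

lemma matrix_inv_eqI:
  fixes A :: "'a::field^'n^'n"
  assumes "A ** B = mat 1"
  shows "matrix_inv A = B"
proof -
  have "invertible A" using assms invertible_right_inverse by blast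
  then show ?thesis
    by (metis assms matrix_inv_mult(2) matrix_mul_assoc matrix_mul_lid matrix_mul_rid)
qed

text \<open>A positive vector with positive image gives a minimum principle: \<open>B *v x\<close>
  nonnegative forces \<open>x\<close> nonnegative. Applied to \<open>x\<close> and
  \<open>- x\<close> it yields a trivial kernel, and applied to the columns of the inverse it yields
  their sign.\<close>

lemma M_matrix_inverse_nonneg:
  fixes B :: "real^'n^'n"
  assumes off: "\<And>i j. i \<noteq> j \<Longrightarrow> B $ i $ j \<le> 0"
    and v: "\<And>i. 0 < v $ i" "\<And>i. 0 < (B *v v) $ i"
  shows "invertible B" "0 \<le> matrix_inv B $ i $ j"
proof -
  have mono: "0 \<le> x $ k" if x: "\<And>i. 0 \<le> (B *v x) $ i" for x k
  proof -
    obtain t i where i: "(x - t *\<^sub>R v) $ i = 0" and pos: "\<And>j. 0 \<le> (x - t *\<^sub>R v) $ j"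
      using ratio_minimum_shift[OF v(1), of x] by blast
    \<comment> \<open>In row \<open>i\<close>, where the shifted vector is zero, the diagonal term
      drops out and the others are nonpositive. This bounds \<open>(B *v x) $ i\<close> by
      \<open>t * (B *v v) $ i\<close>, which yields \<open>0 \<le> t\<close>.\<close>
    have "B $ i $ j * (x - t *\<^sub>R v) $ j \<le> 0" for j
      using off[of i j] pos[of j] i
      by (cases "i = j") (simp_all only: mult_nonpos_nonneg mult_zero_right order_refl not_False_eq_True)
    then have "(\<Sum>j\<in>UNIV. B $ i $ j * (x - t *\<^sub>R v) $ j) \<le> 0"
      by (rule sum_nonpos)
    then have "(B *v (x - t *\<^sub>R v)) $ i \<le> 0"
      by (simp only: matrix_vector_mult_def vec_lambda_beta)
    then have "(B *v x) $ i \<le> t * (B *v v) $ i"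
      by (simp add: matrix_vector_mult_diff_distrib matrix_vector_mult_scaleR)
    then have "0 \<le> t * (B *v v) $ i" using x[of i] by linarith
    then have "0 \<le> t" using v(2)[of i] by (simp add: zero_le_mult_iff)
    then have "0 \<le> t * v $ k" using v(1)[of k] by simp
    then show ?thesis using pos[of k] by simp
  qed
  have "x = 0" if "B *v x = 0" for x
  proof -
    have "B *v (- x) = 0"
      using that by (metis matrix_vector_mult_scaleR scaleR_minus1_left scaleR_zero_right)
    then have "0 \<le> x $ k" "0 \<le> (- x) $ k" for k
      using that mono[of x k] mono[of "- x" k] by simp_all
    then show ?thesis by (metis antisym neg_0_le_iff_le vec_eq_iff vector_uminus_component zero_index)
  qed
  then show inv: "invertible B"
    by (simp add: invertible_left_inverse matrix_left_invertible_ker)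
  have "0 \<le> (matrix_inv B *v axis j 1) $ i"
    by (rule mono) (simp add: matrix_vector_mul_assoc matrix_inv_mult[OF inv] axis_def)
  then show "0 \<le> matrix_inv B $ i $ j"
    by (simp add: matrix_vector_mul_component inner_axis)
qed

text \<open>In the norm given by the maximum of \<open>cmod (z $ i) / w $ i\<close>, the nonnegative
  matrix \<open>A\<close> is a contraction because it fixes \<open>w\<close>. So no eigenvalue has
  modulus above 1, and \<open>w\<close> itself gives the eigenvalue 1.\<close>

lemma spectral_radius_eq_1:
  fixes A :: "real^'n^'n"
  assumes A: "\<And>i j. 0 \<le> A $ i $ j" and w: "\<And>i. 0 < w $ i" "A *v w = w"
  shows "spectral_radius A = 1"
proof -
  have "is_eigenvalue A 1"
    unfolding is_eigenvalue_def
  proof (intro exI conjI)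
    show "(\<chi> i. complex_of_real (w $ i)) \<noteq> 0"
      using w(1) by (auto simp: vec_eq_iff) (metis less_irrefl)
    have "(\<Sum>j\<in>UNIV. complex_of_real (A $ i $ j) * complex_of_real (w $ j)) = complex_of_real (w $ i)" for i
      using arg_cong[OF w(2), of "\<lambda>z. complex_of_real (z $ i)"]
      by (simp add: matrix_vector_mult_def)
    then show "map_matrix complex_of_real A *v (\<chi> i. complex_of_real (w $ i)) =
        1 *s (\<chi> i. complex_of_real (w $ i))"
      by (simp add: vec_eq_iff matrix_vector_mult_def map_matrix_def)
  qed
  moreover have "cmod \<mu> \<le> 1" if \<mu>: "is_eigenvalue A \<mu>" for \<mu>
  proof -
    obtain z where z: "z \<noteq> 0" "map_matrix complex_of_real A *v z = \<mu> *s z"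
      using \<mu> unfolding is_eigenvalue_def by blast
    \<comment> \<open>Negating the ratios turns the minimiser of \<open>finite_argmin\<close> into a
      maximiser.\<close>
    obtain i where "\<And>j. - (cmod (z $ i) / w $ i) \<le> - (cmod (z $ j) / w $ j)"
      using finite_argmin[of "\<lambda>j. - (cmod (z $ j) / w $ j)"] by blast
    then have i: "cmod (z $ j) / w $ j \<le> cmod (z $ i) / w $ i" for j by simp
    define t where "t = cmod (z $ i) / w $ i"
    have zt: "cmod (z $ j) \<le> t * w $ j" for j
      using i[of j] w(1)[of j] by (simp add: t_def pos_divide_le_eq)
    have zi: "cmod (z $ i) = t * w $ i"
      using w(1)[of i] by (simp add: t_def)
    have tpos: "0 < t"
    proof (rule ccontr)
      assume "\<not> 0 < t"
      then have "cmod (z $ j) \<le> 0" for j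
        using zt[of j] w(1)[of j] mult_nonpos_nonneg[of t "w $ j"] by linarith
      then show False using z(1) by (simp add: vec_eq_iff)
    qed
    have "cmod \<mu> * (t * w $ i) = cmod ((\<mu> *s z) $ i)" by (simp add: norm_mult zi)
    also have "\<dots> = cmod (\<Sum>j\<in>UNIV. complex_of_real (A $ i $ j) * z $ j)"
      by (simp add: z(2)[symmetric] matrix_vector_mult_def map_matrix_def)
    also have "\<dots> \<le> (\<Sum>j\<in>UNIV. A $ i $ j * (t * w $ j))"
      by (intro order.trans[OF norm_sum] sum_mono)
        (simp add: norm_mult A mult_left_mono zt)
    also have "\<dots> = t * (A *v w) $ i"
      by (simp add: matrix_vector_mult_def sum_distrib_left mult_ac)
    finally show ?thesis
      using tpos w(1)[of i] by (simp add: w(2))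
  qed
  ultimately show ?thesis
    unfolding spectral_radius_def
    by (intro cSup_eq_maximum) (auto intro!: image_eqI[of _ _ 1])
qed

section \<open>The bounds for constant eigenvectors\<close>

lemma diag_matrix_mult: "diag_matrix d ** A = (\<chi> i j. d $ i * A $ i $ j)"
  by (simp add: vec_eq_iff matrix_matrix_mult_def diag_matrix_def if_distribR if_distrib cong: if_cong)

lemma matrix_inv_diag_matrix:
  fixes d :: "real^'n"
  assumes "\<And>i. d $ i \<noteq> 0"
  shows "matrix_inv (diag_matrix d) = diag_matrix (\<chi> i. 1 / d $ i)"
proof (rule matrix_inv_eqI)
  show "diag_matrix d ** diag_matrix (\<chi> i. 1 / d $ i) = mat 1"
    unfolding diag_matrix_mult using assms by (simp add: vec_eq_iff diag_matrix_def mat_def)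
qed

lemma mult_diag_matrix: "A ** diag_matrix d = (\<chi> i j. A $ i $ j * d $ j)"
  by (simp add: vec_eq_iff matrix_matrix_mult_def diag_matrix_def if_distribR if_distrib cong: if_cong)

lemma diag_matrix_mult_vec: "diag_matrix d *v x = (\<chi> i. d $ i * x $ i)"
  by (simp add: vec_eq_iff matrix_vector_mult_def diag_matrix_def if_distribR if_distrib cong: if_cong)

lemma sum_prod_UNIV:
  "(\<Sum>a\<in>UNIV. f (a :: 'm::finite \<times> 'r::finite)) = (\<Sum>l\<in>UNIV. \<Sum>i\<in>UNIV. f (l, i))"
  by (simp add: sum.cartesian_product UNIV_Times_UNIV[symmetric] del: UNIV_Times_UNIV)

lemma kronecker_mult_stack_const:
  assumes "\<And>l. (\<Sum>k\<in>UNIV. P $ l $ k) = 1"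
  shows "(P \<otimes>\<^sub>K mat 1) *v stack (\<lambda>_. x) = stack (\<lambda>_. x)"
proof -
  have "(\<Sum>k\<in>UNIV. \<Sum>j\<in>UNIV. P $ l $ k * (if i = j then 1 else 0) * x $ j) = x $ i" for l i
    by (simp add: if_distrib if_distribR sum_distrib_right[symmetric] assms cong: if_cong)
  then show ?thesis
    by (simp add: vec_eq_iff matrix_vector_mult_def kronecker_def stack_def mat_def sum_prod_UNIV)
qed

lemma block_diag_mult_stack: "block_diag B *v stack w = stack (\<lambda>l. B l *v w l)"
proof -
  have "(block_diag B *v stack w) $ (l, i) = stack (\<lambda>l. B l *v w l) $ (l, i)" for l i
  proof -
    have "(block_diag B *v stack w) $ (l, i) =
        (\<Sum>k\<in>UNIV. \<Sum>j\<in>UNIV. if l = k then B l $ i $ j * w k $ j else 0)"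
      by (auto simp: matrix_vector_mult_def block_diag_def stack_def sum_prod_UNIV intro!: sum.cong)
    also have "\<dots> = (\<Sum>j\<in>UNIV. B l $ i $ j * w l $ j)"
      by (subst sum.swap) simp
    finally show ?thesis by (simp add: stack_def matrix_vector_mult_def)
  qed
  then show ?thesis by (auto simp: vec_eq_iff)
qed

text \<open>Since \<open>K\<close> fixes \<open>w\<close>, it can be inserted after
  \<open>A\<close>; stationarity of \<open>p\<close> under \<open>A ** K\<close> then absorbs both
  factors. In the application \<open>K\<close> is the environment factor and \<open>w\<close> the
  stacked logarithm of the common eigenvector.\<close>

lemma stationary_distribution_correction_zero:
  assumes "stationary_distribution (A ** K) p" "K *v w = w"
  shows "p \<bullet> ((mat 1 - A) *v w) = 0"
proof -
  have "p \<bullet> (A *v w) = (p v* (A ** K)) \<bullet> w"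
    by (simp add: dot_lmul_matrix matrix_vector_mul_assoc[symmetric] assms(2))
  also have "\<dots> = p \<bullet> w" using assms(1) by (simp add: stationary_distribution_def)
  finally show ?thesis
    by (simp add: matrix_vector_mult_diff_rdistrib inner_diff_right)
qed

text \<open>The matrix inverted in \<open>M_block\<close> maps \<open>v\<close> to
  \<open>rates Q $ l *\<^sub>R v\<close>, which is positive. Hence \<open>v\<close> certifies the
  M-matrix property, and inverting the same identity shows that \<open>v\<close> is fixed.\<close>

lemma M_block_Perron:
  assumes nonneg: "\<And>i j. i \<noteq> j \<Longrightarrow> 0 \<le> \<Omega> l $ i $ j"
    and v: "\<And>i. 0 < v $ i" "\<Omega> l *v v = lam $ l *\<^sub>R v" and c: "0 < rates Q $ l"
  shows "0 \<le> M_block Q \<Omega> lam l $ i $ j" "M_block Q \<Omega> lam l *v v = v"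
proof -
  define B where "B = (rates Q $ l + lam $ l) *\<^sub>R mat 1 - \<Omega> l"
  have Bv: "B *v v = rates Q $ l *\<^sub>R v"
    by (simp add: B_def matrix_vector_mult_diff_rdistrib scaleR_matrix_vector_assoc[symmetric]
        v scaleR_add_left matrix_vector_mult_add_rdistrib)
  have B: "i \<noteq> j \<Longrightarrow> B $ i $ j \<le> 0" for i j
    using nonneg[of i j] by (simp add: B_def mat_def)
  note inv = M_matrix_inverse_nonneg[of B v, OF B v(1)]
  have "\<And>i. 0 < (B *v v) $ i" using c v(1) by (simp add: Bv)
  note inv = inv[OF _ this]
  show "0 \<le> M_block Q \<Omega> lam l $ i $ j"
    using inv(2)[of i j] c by (simp add: M_block_def B_def)
  have "M_block Q \<Omega> lam l *v v = matrix_inv B *v (B *v v)"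
    by (simp add: M_block_def B_def[symmetric] Bv scaleR_matrix_vector_assoc[symmetric]
        matrix_vector_mult_scaleR)
  also have "\<dots> = v"
    by (simp add: matrix_vector_mul_assoc matrix_inv_mult inv(1))
  finally show "M_block Q \<Omega> lam l *v v = v" .
qed

lemma spectral_radius_upper_bound:
  fixes P :: "real^'m^'m" and B :: "'m \<Rightarrow> real^'r^'r"
  assumes P: "\<And>l k. 0 \<le> P $ l $ k" "\<And>l. (\<Sum>k\<in>UNIV. P $ l $ k) = 1"
    and B: "\<And>l i j. 0 \<le> B l $ i $ j" "\<And>l. B l *v x = x" and x: "\<And>i. 0 < x $ i"
  shows "spectral_radius (block_diag B ** (P \<otimes>\<^sub>K mat 1)) = 1"
proof (rule spectral_radius_eq_1)
  show "0 \<le> (block_diag B ** (P \<otimes>\<^sub>K mat 1)) $ a $ b" for a b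
    by (auto simp: matrix_matrix_mult_def block_diag_def kronecker_def mat_def B P
        intro!: sum_nonneg mult_nonneg_nonneg)
  show "0 < stack (\<lambda>_::'m. x) $ a" for a by (simp add: stack_def x)
  show "(block_diag B ** (P \<otimes>\<^sub>K mat 1)) *v stack (\<lambda>_. x) = stack (\<lambda>_. x)"
    by (simp add: matrix_vector_mul_assoc[symmetric] kronecker_mult_stack_const P
        block_diag_mult_stack B)
qed

text \<open>With one common eigenvector, both products run over \<open>x $ \<phi> l\<close> for
  \<open>l\<close> from 0 to \<open>m\<close>: the numerator after an index shift, the denominator
  because its separate factor at \<open>\<phi> 0\<close> supplies the term at 0.\<close>

lemma R0_const:
  assumes "\<And>i. 0 < x $ i"
  shows "R0 st (Suc m) (\<lambda>_. x) \<phi> = 1"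
proof -
  have "(\<Prod>l=1..Suc m. x $ \<phi> (l - 1)) = (\<Prod>l=0..m. x $ \<phi> l)"
    by (rule prod.reindex_bij_witness[of _ Suc "\<lambda>l. l - 1"]) auto
  also have "\<dots> = x $ \<phi> 0 * (\<Prod>l=1..m. x $ \<phi> l)"
    by (simp add: prod.atLeast_Suc_atMost)
  finally have "R0 st (Suc m) (\<lambda>_. x) \<phi> =
      (x $ \<phi> 0 * (\<Prod>l=1..m. x $ \<phi> l)) / (x $ \<phi> 0 * (\<Prod>l=1..m. x $ \<phi> l))"
    by (simp add: R0_def)
  moreover have "x $ \<phi> l \<noteq> 0" for l
    using assms[of "\<phi> l"] by simp
  ultimately show ?thesis by simp
qed

text \<open>The conditional expectation of the constant 1 is the total mass of a probability mass
  function, so the logarithm under each integral is 0.\<close>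

lemma omega_L_star_const:
  assumes "\<And>i. 0 < x $ i"
  shows "omega_L_star st Q \<Omega> p lam (\<lambda>_::'m::finite. x) \<alpha> = mean_drift Q p lam"
proof -
  obtain m where m: "CARD('m) = Suc m"
    using not0_implies_Suc[of "CARD('m)"] by auto
  have "cond_exp_R0 st \<Omega> lam (\<lambda>_. x) i j z = 1" for i j z
    unfolding cond_exp_R0_def m R0_const[OF assms, abs_def]
    by (simp add: R0_const[OF assms] measure_pmf.prob_space del: chain_pmf.simps)
  then show ?thesis by (simp add: omega_L_star_def)
qed

section \<open>Matrix exponentials and products\<close>

definition mat_pow :: "real^'n^'n \<Rightarrow> nat \<Rightarrow> real^'n^'n" where
  "mat_pow A n = (((**) A) ^^ n) (mat 1)"

lemma mat_pow_simps: "mat_pow A 0 = mat 1" "mat_pow A (Suc n) = A ** mat_pow A n"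
  by (simp_all add: mat_pow_def)

lemma mat_pow_nth_Suc: "mat_pow A (Suc n) $ i $ j = (\<Sum>k\<in>UNIV. A $ i $ k * mat_pow A n $ k $ j)"
  by (simp add: mat_pow_simps matrix_matrix_mult_def)

lemma mat_pow_entry_bound:
  fixes A :: "real^'n^'n"
  defines "K \<equiv> \<Sum>i\<in>UNIV. \<Sum>j\<in>UNIV. \<bar>A $ i $ j\<bar>"
  shows "\<bar>mat_pow A n $ i $ j\<bar> \<le> K ^ n"
proof (induction n arbitrary: i)
  case 0
  show ?case by (simp add: mat_pow_simps mat_def)
next
  case (Suc n)
  have K: "0 \<le> K" by (simp add: K_def sum_nonneg)
  have "\<bar>mat_pow A (Suc n) $ i $ j\<bar> \<le> (\<Sum>k\<in>UNIV. \<bar>A $ i $ k\<bar> * K ^ n)"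
    unfolding mat_pow_nth_Suc
    by (intro order.trans[OF sum_abs] sum_mono) (simp add: abs_mult Suc mult_left_mono)
  also have "\<dots> = (\<Sum>k\<in>UNIV. \<bar>A $ i $ k\<bar>) * K ^ n"
    by (simp add: sum_distrib_right)
  also have "(\<Sum>k\<in>UNIV. \<bar>A $ i $ k\<bar>) \<le> K"
    unfolding K_def by (rule member_le_sum) (auto intro: sum_nonneg)
  finally show ?case using K by (simp add: mult_right_mono)
qed

lemma summable_mat_exp_entries:
  "summable (\<lambda>n. norm (mat_pow A n $ i $ j / fact n))"
proof (rule summable_comparison_test)
  let ?K = "\<Sum>i\<in>UNIV. \<Sum>j\<in>UNIV. \<bar>A $ i $ j\<bar>"
  show "summable (\<lambda>n. ?K ^ n /\<^sub>R fact n)" by (rule summable_exp_generic)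
  show "\<exists>N. \<forall>n\<ge>N. norm (norm (mat_pow A n $ i $ j / fact n)) \<le> ?K ^ n /\<^sub>R fact n"
    using mat_pow_entry_bound[of A _ i j] by (auto simp: divide_inverse_commute abs_mult intro!: mult_left_mono)
qed

text \<open>The entrywise form gives signs and Cauchy products; the form in the matrix space can be
  pushed through bounded linear maps.\<close>

lemma mat_exp_nth: "mat_exp A $ i $ j = (\<Sum>n. mat_pow A n $ i $ j / fact n)"
  and mat_exp_sums: "(\<lambda>n. mat_pow A n /\<^sub>R fact n) sums mat_exp A"
proof -
  have "(\<lambda>n. mat_pow A n /\<^sub>R fact n) sums (\<chi> i j. \<Sum>n. mat_pow A n $ i $ j / fact n)"
    unfolding sums_def
  proof (intro vec_tendstoI)
    fix i j
    show "(\<lambda>n. (\<Sum>i<n. mat_pow A i /\<^sub>R fact i) $ i $ j) \<longlonglongrightarrow>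
        (\<chi> i j. \<Sum>n. mat_pow A n $ i $ j / fact n) $ i $ j"
      using summable_LIMSEQ[OF summable_norm_cancel[OF summable_mat_exp_entries[of A i j]]]
      by (simp add: divide_inverse_commute)
  qed
  moreover have "mat_exp A = (\<Sum>n. mat_pow A n /\<^sub>R fact n)"
    by (simp add: mat_exp_def mat_pow_def divide_inverse)
  ultimately show "(\<lambda>n. mat_pow A n /\<^sub>R fact n) sums mat_exp A"
    "mat_exp A $ i $ j = (\<Sum>n. mat_pow A n $ i $ j / fact n)"
    by (simp_all add: sums_iff)
qed

lemma mat_pow_eigenvector:
  assumes "A *v x = l *\<^sub>R x"
  shows "mat_pow A n *v x = (l ^ n) *\<^sub>R x"
  by (induction n)
    (simp_all add: mat_pow_simps matrix_vector_mul_assoc[symmetric] matrix_vector_mult_scaleR assms mult.commute)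

lemma mat_exp_eigenvector:
  assumes "A *v x = l *\<^sub>R x"
  shows "mat_exp A *v x = exp l *\<^sub>R x"
proof -
  have "bounded_linear (\<lambda>M::real^'a^'a. M *v x)"
    by (intro linear_conv_bounded_linear[THEN iffD1] linearI)
      (simp_all add: matrix_vector_mult_add_rdistrib scaleR_matrix_vector_assoc)
  from bounded_linear.sums[OF this mat_exp_sums[of A]]
  have "(\<lambda>n. (l ^ n /\<^sub>R fact n) *\<^sub>R x) sums (mat_exp A *v x)"
    by (simp add: scaleR_matrix_vector_assoc[symmetric] mat_pow_eigenvector[OF assms])
  moreover have "(\<lambda>n. (l ^ n /\<^sub>R fact n) *\<^sub>R x) sums (exp l *\<^sub>R x)"
    by (intro sums_scaleR_left exp_converges)
  ultimately show ?thesis by (rule sums_unique2)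
qed

text \<open>The binomial theorem for \<open>A\<close> and a multiple of the identity, divided by
  \<open>fact n\<close> so that the right-hand side is the convolution of two exponential series.
  The induction shows that the convolution obeys the recursion of the left-hand side.\<close>

lemma mat_pow_shift:
  fixes A :: "real^'n^'n"
  shows "mat_pow (A + s *\<^sub>R mat 1) n $ i $ j / fact n =
    (\<Sum>k\<le>n. (mat_pow A k $ i $ j / fact k) * (s ^ (n - k) / fact (n - k)))"
proof (induction n arbitrary: i)
  case 0
  show ?case by (simp add: mat_pow_simps)
next
  case (Suc n)
  define a where "a k i = mat_pow A k $ i $ j / fact k" for k i
  define c :: "nat \<Rightarrow> real" where "c k = s ^ k / fact k" for k
  define T where "T n i = (\<Sum>k\<le>n. a k i * c (n - k))" for n i
  have a: "real (Suc k) * a (Suc k) i = (\<Sum>h\<in>UNIV. A $ i $ h * a k h)" for k i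
    by (simp add: a_def mat_pow_nth_Suc sum_divide_distrib[symmetric] del: of_nat_Suc)
  have c: "real (Suc k) * c (Suc k) = s * c k" for k
    by (simp add: c_def del: of_nat_Suc)
  \<comment> \<open>As in the product rule for derivatives, \<open>Suc n\<close> is split into
    \<open>k\<close> and \<open>Suc n - k\<close>; the first weight lowers the index of
    \<open>a\<close>, the second that of \<open>c\<close>.\<close>
  have "real (Suc n) * T (Suc n) i =
      (\<Sum>k\<le>Suc n. real k * a k i * c (Suc n - k)) +
      (\<Sum>k\<le>Suc n. a k i * (real (Suc n - k) * c (Suc n - k)))"
    by (simp add: T_def sum_distrib_left sum.distrib[symmetric] algebra_simps of_nat_diff
        del: sum.atMost_Suc of_nat_Suc cong: sum.cong_simp)
  \<comment> \<open>The weight \<open>k\<close> kills the term at 0, so the index can be shifted; in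
    the other sum the weight \<open>Suc n - k\<close> kills the top term.\<close>
  also have "(\<Sum>k\<le>Suc n. real k * a k i * c (Suc n - k)) =
      (\<Sum>k\<le>n. (\<Sum>h\<in>UNIV. A $ i $ h * a k h) * c (n - k))"
    by (subst sum.atMost_Suc_shift) (simp add: a del: of_nat_Suc)
  also have "\<dots> = (\<Sum>h\<in>UNIV. A $ i $ h * T n h)"
    unfolding T_def sum_distrib_right sum_distrib_left
    by (subst sum.swap) (simp add: mult_ac)
  also have "(\<Sum>k\<le>Suc n. a k i * (real (Suc n - k) * c (Suc n - k))) =
      (\<Sum>k\<le>n. a k i * (real (Suc (n - k)) * c (Suc (n - k))))"
    by (auto simp: Suc_diff_le of_nat_diff intro!: sum.cong)
  also have "\<dots> = s * T n i"
    by (simp only: c T_def sum_distrib_left mult_ac)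
  finally have T: "real (Suc n) * T (Suc n) i = (\<Sum>h\<in>UNIV. A $ i $ h * T n h) + s * T n i" .
  have IH: "mat_pow (A + s *\<^sub>R mat 1) n $ h $ j = fact n * T n h" for h
    using Suc.IH[of h] by (simp add: T_def a_def c_def field_simps)
  have "mat_pow (A + s *\<^sub>R mat 1) (Suc n) $ i $ j =
      (\<Sum>h\<in>UNIV. A $ i $ h * (fact n * T n h)) +
      (\<Sum>h\<in>UNIV. (if i = h then s * (fact n * T n h) else 0))"
    unfolding mat_pow_nth_Suc IH sum.distrib[symmetric]
    by (rule sum.cong) (auto simp: mat_def distrib_right)
  also have "\<dots> = fact n * ((\<Sum>h\<in>UNIV. A $ i $ h * T n h) + s * T n i)"
    by (simp add: sum_distrib_left algebra_simps)
  also have "\<dots> = fact (Suc n) * T (Suc n) i"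
    unfolding T[symmetric] by simp
  finally show ?case
    by (simp add: T_def a_def c_def del: sum.atMost_Suc fact_Suc)
qed

lemma mat_exp_shift: "mat_exp (A + s *\<^sub>R mat 1) $ i $ j = exp s * mat_exp A $ i $ j"
proof -
  have "summable (\<lambda>n. norm (s ^ n / fact n))"
    using summable_norm_exp[of s] by (simp add: divide_inverse_commute)
  from Cauchy_product_sums[OF summable_mat_exp_entries[of A i j] this]
  have "(\<lambda>n. mat_pow (A + s *\<^sub>R mat 1) n $ i $ j / fact n) sums
      (mat_exp A $ i $ j * (\<Sum>n. s ^ n / fact n))"
    by (simp add: mat_pow_shift mat_exp_nth)
  moreover have "(\<Sum>n. s ^ n / fact n) = exp s"
    by (simp add: exp_def divide_inverse_commute)
  ultimately show ?thesis
    by (simp add: mat_exp_nth sums_iff)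
qed

text \<open>Only the diagonal can be negative. Adding a large multiple of the identity makes all
  powers nonnegative and changes the exponential by a positive factor only.\<close>

lemma mat_exp_nonneg:
  fixes A :: "real^'n^'n"
  assumes "\<And>i j. i \<noteq> j \<Longrightarrow> 0 \<le> A $ i $ j"
  shows "0 \<le> mat_exp A $ i $ j"
proof -
  define s where "s = (\<Sum>i\<in>UNIV. \<bar>A $ i $ i\<bar>)"
  define B where "B = A + s *\<^sub>R mat 1"
  have "\<bar>A $ i $ i\<bar> \<le> s" for i
    unfolding s_def by (rule member_le_sum) auto
  then have "0 \<le> A $ i $ i + s" for i
    by (smt (verit, best))
  then have B: "0 \<le> B $ i $ j" for i j
    using assms[of i j] by (simp add: B_def mat_def)
  have "0 \<le> mat_pow B n $ i $ j" for n i
    by (induction n arbitrary: i)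
      (auto simp: mat_pow_nth_Suc B mat_pow_simps(1) mat_def intro!: sum_nonneg mult_nonneg_nonneg)
  then have "0 \<le> mat_exp B $ i $ j"
    unfolding mat_exp_nth
    by (intro suminf_nonneg summable_norm_cancel[OF summable_mat_exp_entries]) simp
  then show ?thesis
    by (simp add: B_def mat_exp_shift zero_le_mult_iff)
qed

section \<open>Products of matrices with a common positive eigenvector\<close>

lemma mat_prod_nonneg:
  assumes "\<And>k i j. 0 \<le> A k $ i $ j"
  shows "0 \<le> mat_prod A n $ i $ j"
  by (induction n arbitrary: j)
    (auto simp: mat_def matrix_matrix_mult_def assms intro!: sum_nonneg mult_nonneg_nonneg)

lemma mat_prod_eigenvector:
  assumes "\<And>k. A k *v x = exp (a k) *\<^sub>R x"
  shows "mat_prod A n *v x = exp (\<Sum>k<n. a k) *\<^sub>R x"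
  by (induction n)
    (simp_all add: matrix_vector_mul_assoc[symmetric] assms matrix_vector_mult_scaleR exp_add mult.commute)

text \<open>In each row of the product, the largest entry weighted by \<open>x\<close> is at least the fraction
  \<open>1 / CARD('r)\<close> of the eigenvalue times the entry of \<open>x\<close>.\<close>

lemma mat_prod_growth:
  fixes A :: "nat \<Rightarrow> real^'r^'r"
  assumes nonneg: "\<And>k i j. 0 \<le> A k $ i $ j"
    and x: "\<And>i. 0 < x $ i" and eig: "\<And>k. A k *v x = exp (a k) *\<^sub>R x"
    and lim: "\<And>i j. (\<lambda>n. 1 / real n * ln (mat_prod A n $ i $ j)) \<longlonglongrightarrow> w"
  shows "(\<lambda>n. (\<Sum>k<n. a k) / real n) \<longlonglongrightarrow> w"
proof -
  fix i0 :: 'r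
  define b where "b n = (\<Sum>k<n. a k)" for n
  define e where "e n j = 1 / real n * ln (mat_prod A n $ i0 $ j)" for n j
  define r where "r = real CARD('r)"
  \<comment> \<open>\<open>K\<close> absorbs the oscillation of \<open>ln x\<close> and the loss of
    \<open>ln r\<close> from replacing a row sum by its largest term.\<close>
  define K where "K = (\<Sum>j\<in>UNIV. \<bar>ln (x $ i0) - ln (x $ j)\<bar>) + ln r"
  have r: "1 \<le> r" by (simp add: r_def Suc_le_eq)
  have bound: "\<bar>b n / real n - w\<bar> \<le> (\<Sum>j\<in>UNIV. \<bar>e n j - w\<bar>) + K / real n" if n: "0 < n" for n
  proof -
    let ?P = "\<lambda>j. mat_prod A n $ i0 $ j"
    obtain j where "\<And>h. - (?P j * x $ j) \<le> - (?P h * x $ h)"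
      using finite_argmin[of "\<lambda>j. - (?P j * x $ j)"] by blast
    then have j: "?P h * x $ h \<le> ?P j * x $ j" for h by simp
    have row: "(\<Sum>h\<in>UNIV. ?P h * x $ h) = exp (b n) * x $ i0"
      using arg_cong[OF mat_prod_eigenvector[of A x a n, OF eig], of "\<lambda>y. y $ i0"]
      by (simp add: matrix_vector_mult_def b_def)
    have "exp (b n) * x $ i0 \<le> r * (?P j * x $ j)"
      unfolding row[symmetric] r_def using sum_bounded_above[of UNIV "\<lambda>h. ?P h * x $ h", OF j]
      by simp
    moreover have "0 < exp (b n) * x $ i0" using x by simp
    \<comment> \<open>Single entries are only known to be nonnegative; the largest weighted one is
      positive because the row total is, so its logarithm is meaningful.\<close>
    ultimately have "0 < r * (?P j * x $ j)" by linarith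
    then have Pj: "0 < ?P j"
      using r x[of j] by (simp add: zero_less_mult_iff)
    have up: "?P j * x $ j \<le> exp (b n) * x $ i0"
      unfolding row[symmetric]
      by (rule member_le_sum) (auto intro!: mult_nonneg_nonneg mat_prod_nonneg nonneg simp: less_imp_le x)
    have "ln (?P j * x $ j) \<le> ln (exp (b n) * x $ i0)"
      using up Pj x[of j] by (intro ln_mono) auto
    then have 1: "ln (?P j) + ln (x $ j) \<le> b n + ln (x $ i0)"
      using Pj x[of j] x[of i0] by (simp add: ln_mult)
    have "ln (exp (b n) * x $ i0) \<le> ln (r * (?P j * x $ j))"
      using \<open>exp (b n) * x $ i0 \<le> _\<close> x[of i0] by (intro ln_mono) auto
    then have 2: "b n + ln (x $ i0) \<le> ln r + (ln (?P j) + ln (x $ j))"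
      using Pj x[of j] x[of i0] r by (simp add: ln_mult)
    have "\<bar>ln (x $ i0) - ln (x $ j)\<bar> \<le> (\<Sum>j\<in>UNIV. \<bar>ln (x $ i0) - ln (x $ j)\<bar>)"
      by (rule member_le_sum) auto
    moreover have "0 \<le> ln r" using r by simp
    ultimately have "\<bar>b n - ln (?P j)\<bar> \<le> K"
      using 1 2 unfolding K_def by linarith
    then have "\<bar>b n - ln (?P j)\<bar> / real n \<le> K / real n"
      using n by (simp add: divide_right_mono)
    moreover have "\<bar>b n / real n - e n j\<bar> = \<bar>b n - ln (?P j)\<bar> / real n"
      using n by (simp add: e_def diff_divide_distrib[symmetric] abs_divide)
    \<comment> \<open>The maximising column \<open>j\<close> depends on \<open>n\<close>; the sum
      over all columns dominates its term and still tends to 0.\<close>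
    moreover have "\<bar>e n j - w\<bar> \<le> (\<Sum>j\<in>UNIV. \<bar>e n j - w\<bar>)"
      by (rule member_le_sum) auto
    ultimately show ?thesis by linarith
  qed
  have "(\<lambda>n. (\<Sum>j\<in>UNIV. \<bar>e n j - w\<bar>) + K / real n) \<longlonglongrightarrow> (\<Sum>j\<in>(UNIV::'r set). \<bar>w - w\<bar>) + 0"
    unfolding e_def by (intro tendsto_intros lim lim_const_over_n)
  then have lim0: "(\<lambda>n. (\<Sum>j\<in>UNIV. \<bar>e n j - w\<bar>) + K / real n) \<longlonglongrightarrow> 0" by simp
  have "(\<lambda>n. b n / real n - w) \<longlonglongrightarrow> 0"
    by (rule Lim_null_comparison[OF _ lim0])
      (use bound in \<open>auto intro!: eventually_mono[OF eventually_gt_at_top[of 0]]\<close>)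
  then show ?thesis
    unfolding b_def by (rule LIM_zero_cancel)
qed

section \<open>The mean drift of the environment\<close>

lemma exponential_measure_moment:
  assumes c: "0 < c"
  shows "has_bochner_integral (exponential_measure c) (\<lambda>s. s ^ i) (fact i / c ^ i)"
proof -
  interpret E: prob_space "exponential_measure c"
    unfolding exponential_measure_def by (rule prob_space_exponential_density[OF c])
  have "distributed (exponential_measure c) lborel (\<lambda>s. s) (exponential_density c)"
    unfolding distributed_def exponential_measure_def
    by (auto simp: distr_id2 cong: measurable_cong_sets)
  from E.has_bochner_integral_erlang_ith_moment[OF c this, of i] show ?thesis by simp
qed

text \<open>Bounded second moments give uniform integrability. The deviation \<open>D\<close> from
  \<open>c\<close> satisfies \<open>\<bar>D\<bar> \<le> min \<bar>D\<bar> T + D^2 / T\<close>;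
  dominated convergence handles the truncated part, the second moment bounds the rest uniformly in
  \<open>n\<close>.\<close>

lemma (in prob_space) expectation_tendsto_const:
  fixes X :: "nat \<Rightarrow> 'a \<Rightarrow> real"
  assumes meas[measurable]: "\<And>n. X n \<in> borel_measurable M"
    and sq: "\<And>n. integrable M (\<lambda>x. (X n x)\<^sup>2)" and K: "\<And>n. expectation (\<lambda>x. (X n x)\<^sup>2) \<le> K"
    and lim: "AE x in M. (\<lambda>n. X n x) \<longlonglongrightarrow> c"
  shows "(\<lambda>n. expectation (X n)) \<longlonglongrightarrow> c"
proof -
  define D where "D n x = X n x - c" for n x
  have [measurable]: "D n \<in> borel_measurable M" for n unfolding D_def by simp
  have int: "integrable M (X n)" for n
    by (rule square_integrable_imp_integrable[OF _ sq]) simp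
  have intD: "integrable M (D n)" for n unfolding D_def by (simp add: int)
  have D_eq: "(D n x)\<^sup>2 = (X n x)\<^sup>2 - 2 * c * X n x + c\<^sup>2" for n x
    by (simp add: D_def power2_eq_square algebra_simps)
  have sqD: "integrable M (\<lambda>x. (D n x)\<^sup>2)" for n
    unfolding D_eq by (simp add: int sq)
  \<comment> \<open>From \<open>(a - c)^2 \<le> 2 * a^2 + 2 * c^2\<close>, a bound for the second
    moment of \<open>D n\<close> uniform in \<open>n\<close>.\<close>
  define L where "L = 2 * K + 2 * c\<^sup>2"
  have L: "expectation (\<lambda>x. (D n x)\<^sup>2) \<le> L" for n
  proof -
    have "(D n x)\<^sup>2 \<le> 2 * (X n x)\<^sup>2 + 2 * c\<^sup>2" for x
      using zero_le_power2[of "X n x + c"] unfolding D_eq by (simp add: power2_eq_square algebra_simps)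
    then have "expectation (\<lambda>x. (D n x)\<^sup>2) \<le> expectation (\<lambda>x. 2 * (X n x)\<^sup>2 + 2 * c\<^sup>2)"
      by (intro integral_mono sqD) (simp_all add: sq)
    also have "\<dots> \<le> L" using K[of n] by (simp add: L_def sq prob_space)
    finally show ?thesis .
  qed
  have "0 \<le> expectation (\<lambda>x. (D 0 x)\<^sup>2)" by (rule integral_nonneg_AE) simp
  then have L0: "0 \<le> L" using L[of 0] by linarith
  have trunc: "(\<lambda>n. expectation (\<lambda>x. min \<bar>D n x\<bar> T)) \<longlonglongrightarrow> 0" if T: "0 < T" for T
  proof -
    have "(\<lambda>n. expectation (\<lambda>x. min \<bar>D n x\<bar> T)) \<longlonglongrightarrow> expectation (\<lambda>x. 0)"
    proof (rule integral_dominated_convergence[where w = "\<lambda>_. T"])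
      show "AE x in M. (\<lambda>n. min \<bar>D n x\<bar> T) \<longlonglongrightarrow> 0"
        using lim
      proof eventually_elim
        case (elim x)
        have "(\<lambda>n. min \<bar>X n x - c\<bar> T) \<longlonglongrightarrow> min \<bar>c - c\<bar> T"
          by (intro tendsto_intros elim)
        then show ?case using T by (simp add: D_def)
      qed
    qed (use T in auto)
    then show ?thesis by simp
  qed
  show ?thesis
  proof (rule LIMSEQ_I)
    fix e :: real assume e: "0 < e"
    \<comment> \<open>Chosen so that the remainder \<open>L / T\<close> is below
      \<open>e / 2\<close>; the summand 1 keeps \<open>T\<close> positive when
      \<open>L = 0\<close>.\<close>
    define T where "T = 2 * (L + 1) / e"
    have T: "0 < T" "L / T < e / 2" using e L0 by (simp_all add: T_def field_simps)
    have "eventually (\<lambda>n. expectation (\<lambda>x. min \<bar>D n x\<bar> T) < e / 2) sequentially"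
      using order_tendstoD(2)[OF trunc[OF T(1)], of "e / 2"] e by simp
    then obtain N where N: "\<And>n. N \<le> n \<Longrightarrow> expectation (\<lambda>x. min \<bar>D n x\<bar> T) < e / 2"
      unfolding eventually_sequentially by blast
    show "\<exists>N. \<forall>n\<ge>N. norm (expectation (X n) - c) < e"
    proof (intro exI allI impI)
      fix n assume n: "N \<le> n"
      have intm: "integrable M (\<lambda>x. min \<bar>D n x\<bar> T)"
        by (rule Bochner_Integration.integrable_bound[OF intD[of n]]) (use T in auto)
      have pt: "\<bar>D n x\<bar> \<le> min \<bar>D n x\<bar> T + (D n x)\<^sup>2 / T" for x
      proof (cases "\<bar>D n x\<bar> \<le> T")
        case False
        then have "T * \<bar>D n x\<bar> \<le> \<bar>D n x\<bar> * \<bar>D n x\<bar>" by (intro mult_right_mono) auto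
        then have "\<bar>D n x\<bar> \<le> (D n x)\<^sup>2 / T"
          using T(1) by (simp add: pos_le_divide_eq power2_eq_square mult.commute)
        then show ?thesis using T(1) by (smt (verit))
      qed (use T in simp)
      have "norm (expectation (X n) - c) = \<bar>expectation (D n)\<bar>"
        by (simp add: D_def[abs_def] int prob_space)
      also have "\<dots> \<le> expectation (\<lambda>x. \<bar>D n x\<bar>)" by (rule integral_abs_bound)
      also have "\<dots> \<le> expectation (\<lambda>x. min \<bar>D n x\<bar> T + (D n x)\<^sup>2 / T)"
        by (intro integral_mono) (use intD intm sqD pt in auto)
      also have "\<dots> = expectation (\<lambda>x. min \<bar>D n x\<bar> T) + expectation (\<lambda>x. (D n x)\<^sup>2) / T"
        using intm sqD[of n] by simp
      also have "\<dots> < e / 2 + e / 2"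
        using N[OF n] T L[of n] by (smt (verit) divide_right_mono)
      finally show "norm (expectation (X n) - c) < e" by simp
    qed
  qed
qed

section \<open>The jump matrix, its stationary distribution and the Poisson equation\<close>

context irreducible_ctmc
begin

lemma matrix_inv_rate_matrix:
  "matrix_inv (rate_matrix Q) = diag_matrix (\<chi> l. 1 / rates Q $ l)"
  unfolding rate_matrix_def using rates_pos by (intro matrix_inv_diag_matrix) (metis less_irrefl)

lemma jump_matrix_nth: "jump_matrix Q $ i $ j = (if i = j then 0 else Q $ i $ j / rates Q $ i)"
proof -
  have "Q $ i $ i + (\<Sum>j\<in>UNIV - {i}. Q $ i $ j) = 0"
    using Q_row_sum[of i] by (simp add: sum.remove[of UNIV i])
  moreover have "0 \<le> (\<Sum>j\<in>UNIV - {i}. Q $ i $ j)"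
    by (intro sum_nonneg Q_nonneg) auto
  ultimately have "Q $ i $ i = - rates Q $ i" by (simp add: rates_def)
  then show ?thesis
    using rates_pos[of i]
    by (cases "i = j") (auto simp: jump_matrix_def matrix_inv_rate_matrix diag_matrix_mult mat_def)
qed

lemma jump_matrix_nonneg: "0 \<le> jump_matrix Q $ i $ j"
  using Q_nonneg[of i j] rates_pos[of i] by (simp add: jump_matrix_nth)

lemma jump_matrix_row_sum: "(\<Sum>j\<in>UNIV. jump_matrix Q $ i $ j) = 1"
  using rates_pos[of i]
  by (simp add: jump_matrix_def matrix_inv_rate_matrix diag_matrix_mult mat_def sum.distrib
      sum_divide_distrib[symmetric] Q_row_sum)

lemma jump_matrix_irreducible: "irreducible_matrix (jump_matrix Q)"
  unfolding irreducible_matrix_def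
proof (intro allI)
  fix i j
  have "{b. (i, b) \<in> {(a, b). jump_matrix Q $ a $ b \<noteq> 0}\<^sup>*} = UNIV"
  proof (rule irreducible_matrix_closed_UNIV[OF Q_irreducible, of i])
    fix a b assume "a \<in> {b. (i, b) \<in> {(a, b). jump_matrix Q $ a $ b \<noteq> 0}\<^sup>*}" "a \<noteq> b" "Q $ a $ b \<noteq> 0"
    moreover from this have "jump_matrix Q $ a $ b \<noteq> 0"
      using rates_pos[of a] by (simp add: jump_matrix_nth)
    ultimately show "b \<in> {b. (i, b) \<in> {(a, b). jump_matrix Q $ a $ b \<noteq> 0}\<^sup>*}"
      by (auto intro: rtrancl_into_rtrancl)
  qed simp
  then show "(i, j) \<in> {(a, b). jump_matrix Q $ a $ b \<noteq> 0}\<^sup>*" by blast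
qed

text \<open>By stationarity the support of \<open>p\<close> is closed under transitions. Positivity
  makes the inverse of \<open>diag_matrix p\<close> in the reversed chain a genuine inverse.\<close>

lemma stationary_distribution_pos:
  assumes p: "stationary_distribution (jump_matrix Q) p"
  shows "0 < p $ l"
proof -
  have p0: "0 \<le> p $ i" for i using p by (simp add: stationary_distribution_def)
  have "(\<Sum>i\<in>UNIV. p $ i) \<noteq> 0" using p by (simp add: stationary_distribution_def)
  then obtain i where i: "p $ i \<noteq> 0" by (meson sum.neutral)
  have "{i. 0 < p $ i} = UNIV"
  proof (rule irreducible_matrix_closed_UNIV[OF jump_matrix_irreducible])
    show "i \<in> {i. 0 < p $ i}" using i p0[of i] by simp
    fix a b assume ab: "a \<in> {i. 0 < p $ i}" "jump_matrix Q $ a $ b \<noteq> 0"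
    have "jump_matrix Q $ a $ b * p $ a \<le> (\<Sum>i\<in>UNIV. jump_matrix Q $ i $ b * p $ i)"
      by (rule member_le_sum) (auto intro!: mult_nonneg_nonneg p0 jump_matrix_nonneg)
    also have "\<dots> = p $ b"
      using p by (simp add: stationary_distribution_def vector_matrix_mult_def vec_eq_iff mult.commute)
    finally show "b \<in> {i. 0 < p $ i}"
      using ab jump_matrix_nonneg[of a b] by (smt (verit) mem_Collect_eq mult_pos_pos)
  qed
  then show ?thesis by blast
qed

lemma reversed_jump_matrix_row_sum:
  assumes p: "stationary_distribution (jump_matrix Q) p"
  shows "(\<Sum>k\<in>UNIV. reversed_jump_matrix Q p $ l $ k) = 1"
proof -
  have pos: "p $ l \<noteq> 0" for l using stationary_distribution_pos[OF p, of l] by simp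
  have "reversed_jump_matrix Q p $ l $ k = jump_matrix Q $ k $ l * p $ k / p $ l" for k
    by (simp add: reversed_jump_matrix_def matrix_inv_diag_matrix pos diag_matrix_mult
        mult_diag_matrix transpose_def)
  then have "(\<Sum>k\<in>UNIV. reversed_jump_matrix Q p $ l $ k) = (p v* jump_matrix Q) $ l / p $ l"
    by (simp add: vector_matrix_mult_def sum_divide_distrib mult.commute)
  then show ?thesis using p pos by (simp add: stationary_distribution_def)
qed

lemma mean_drift_eq: "mean_drift Q p lam = p \<bullet> (\<chi> l. lam $ l / rates Q $ l)"
  by (simp add: mean_drift_def matrix_inv_rate_matrix diag_matrix_mult_vec)

text \<open>Solvability of the Poisson equation: \<open>I - P + 1p\<close> is invertible because harmonic functions
  of an irreducible chain are constant.\<close>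

lemma poisson_equation:
  assumes p: "stationary_distribution (jump_matrix Q) p"
  shows "\<exists>g. f - (\<chi> i. p \<bullet> f) = g - jump_matrix Q *v g"
proof -
  define F where "F = (\<lambda>g::real^'m. g - jump_matrix Q *v g + (\<chi> i. p \<bullet> g))"
  have one: "p \<bullet> (\<chi> i. t) = t" for t :: real
    using p by (simp add: inner_vec_def stationary_distribution_def sum_distrib_right[symmetric])
  have Pp: "p \<bullet> (jump_matrix Q *v g) = p \<bullet> g" for g
    using p by (simp add: dot_lmul_matrix[symmetric] stationary_distribution_def)
  \<comment> \<open>\<open>F\<close> preserves the pairing with \<open>p\<close>. On the kernel of
    \<open>F\<close> this leaves a harmonic \<open>g\<close> of mean zero, and for a preimage of
    \<open>f\<close> it identifies the constant as \<open>p \<bullet> f\<close>.\<close>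
  have pF: "p \<bullet> F g = p \<bullet> g" for g
    by (simp add: F_def inner_add_right inner_diff_right one Pp)
  have lin: "linear F"
    by (rule linearI)
      (simp_all add: F_def vec_eq_iff matrix_vector_right_distrib matrix_vector_mult_scaleR
        inner_add_right algebra_simps)
  have "inj F"
    unfolding linear_injective_0[OF lin]
  proof (intro allI impI)
    fix g assume g: "F g = 0"
    have pg: "p \<bullet> g = 0" using pF[of g] g by simp
    then have "jump_matrix Q *v g = 1 *\<^sub>R g"
      using g by (simp add: F_def vec_eq_iff)
    moreover have "jump_matrix Q *v (\<chi> i. 1) = 1 *\<^sub>R (\<chi> i. 1)"
      by (simp add: matrix_vector_mult_def jump_matrix_row_sum vec_eq_iff)
    ultimately obtain t where t: "g = t *\<^sub>R (\<chi> i. 1)"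
      using Perron_eigenspace[OF jump_matrix_nonneg jump_matrix_irreducible, of "\<chi> i. 1" 1 g] by auto
    then show "g = 0" using pg one[of 1] by simp
  qed
  then have "surj F" using lin by (simp add: linear_injective_imp_surjective)
  then obtain g where g: "F g = f" by (metis surjD)
  then have "p \<bullet> g = p \<bullet> f" using pF by metis
  then have "f - (\<chi> i. p \<bullet> f) = g - jump_matrix Q *v g"
    by (simp add: g[symmetric] F_def)
  then show ?thesis by blast
qed

section \<open>Marginal laws of the jump chain and of the sojourn times\<close>

definition state_prob :: "nat \<Rightarrow> 'm \<Rightarrow> real" where
  "state_prob k l = prob {x \<in> space Pr. Y k x = l}"

lemma Y_event[measurable]: "{x \<in> space Pr. Y k x = l} \<in> events"
  using measurable_sets[OF Y_measurable[of k], of "{l}"]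
  by (simp add: vimage_def Int_def conj_commute)

lemma path_event[measurable]: "{x \<in> space Pr. \<forall>j\<le>k. Y j x = y j} \<in> events"
proof -
  have "{x \<in> space Pr. \<forall>j\<le>k. Y j x = y j} = (\<Inter>j\<le>k. {x \<in> space Pr. Y j x = y j})" by auto
  also have "\<dots> \<in> events" by (intro sets.finite_INT) auto
  finally show ?thesis .
qed

text \<open>The laws of the environment are given for whole histories; marginals are sums over them.
  Extensional functions make the histories up to \<open>k\<close> a finite set in which distinct
  elements differ at some time.\<close>

abbreviation paths :: "nat \<Rightarrow> (nat \<Rightarrow> 'm) set" where
  "paths k \<equiv> PiE {..k} (\<lambda>_. UNIV)"

lemma finite_paths: "finite (paths k)"
  by (intro finite_PiE) auto

lemma prob_split_paths:
  assumes E[measurable]: "E \<in> events"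
  shows "prob E = (\<Sum>y\<in>paths k. prob {x \<in> E. \<forall>j\<le>k. Y j x = y j})"
proof -
  have "E = (\<Union>y\<in>paths k. {x \<in> E. \<forall>j\<le>k. Y j x = y j})"
  proof (intro set_eqI iffI)
    fix x assume "x \<in> E"
    then show "x \<in> (\<Union>y\<in>paths k. {x \<in> E. \<forall>j\<le>k. Y j x = y j})"
      by (intro UN_I[of "restrict (\<lambda>j. Y j x) {..k}"]) auto
  qed auto
  also have "prob \<dots> = (\<Sum>y\<in>paths k. prob {x \<in> E. \<forall>j\<le>k. Y j x = y j})"
  proof (rule finite_measure_finite_Union[OF finite_paths])
    have "{x \<in> E. \<forall>j\<le>k. Y j x = y j} = E \<inter> {x \<in> space Pr. \<forall>j\<le>k. Y j x = y j}" for y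
      using sets.sets_into_space[OF E] by auto
    then show "(\<lambda>y. {x \<in> E. \<forall>j\<le>k. Y j x = y j}) ` paths k \<subseteq> events" by auto
    show "disjoint_family_on (\<lambda>y. {x \<in> E. \<forall>j\<le>k. Y j x = y j}) (paths k)"
      unfolding disjoint_family_on_def
    proof (intro ballI impI)
      fix y z assume yz: "y \<in> paths k" "z \<in> paths k" "y \<noteq> z"
      then obtain j where "j \<le> k" "y j \<noteq> z j"
        by (metis PiE_ext atMost_iff)
      then show "{x \<in> E. \<forall>j\<le>k. Y j x = y j} \<inter> {x \<in> E. \<forall>j\<le>k. Y j x = z j} = {}"
        by (auto simp: disjoint_iff)
    qed
  qed
  finally show ?thesis .
qed

lemma state_prob_sum_paths:
  "state_prob k l = (\<Sum>y\<in>paths k. if y k = l then prob {x \<in> space Pr. \<forall>j\<le>k. Y j x = y j} else 0)"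
  unfolding state_prob_def prob_split_paths[OF Y_event, of k l k]
proof (rule sum.cong[OF refl])
  fix y
  have "{x \<in> {x \<in> space Pr. Y k x = l}. \<forall>j\<le>k. Y j x = y j} =
      (if y k = l then {x \<in> space Pr. \<forall>j\<le>k. Y j x = y j} else {})"
    by auto
  then show "prob {x \<in> {x \<in> space Pr. Y k x = l}. \<forall>j\<le>k. Y j x = y j} =
      (if y k = l then prob {x \<in> space Pr. \<forall>j\<le>k. Y j x = y j} else 0)"
    by simp
qed

lemma state_prob_Suc: "state_prob (Suc k) l = (\<Sum>i\<in>UNIV. state_prob k i * jump_matrix Q $ i $ l)"
proof -
  let ?E = "\<lambda>k y. {x \<in> space Pr. \<forall>j\<le>k. Y j x = y j}"
  have step: "prob (?E (Suc k) y) = prob (?E k y) * jump_matrix Q $ y k $ y (Suc k)" for y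
    using jump_chain_law[of "Suc k" y] jump_chain_law[of k y] by simp
  have "state_prob (Suc k) l = (\<Sum>y\<in>paths k. prob {x \<in> {x \<in> space Pr. Y (Suc k) x = l}. \<forall>j\<le>k. Y j x = y j})"
    unfolding state_prob_def by (rule prob_split_paths) simp
  also have "\<dots> = (\<Sum>y\<in>paths k. prob (?E k y) * jump_matrix Q $ y k $ l)"
  proof (rule sum.cong[OF refl])
    fix y
    \<comment> \<open>A history up to \<open>k\<close> followed by state \<open>l\<close> is the
      history \<open>y(Suc k := l)\<close> up to \<open>Suc k\<close>, to which the one-step law
      applies.\<close>
    have "{x \<in> {x \<in> space Pr. Y (Suc k) x = l}. \<forall>j\<le>k. Y j x = y j} = ?E (Suc k) (y(Suc k := l))"
      by (auto simp: le_Suc_eq)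
    moreover have "?E k (y(Suc k := l)) = ?E k y" by auto
    ultimately show "prob {x \<in> {x \<in> space Pr. Y (Suc k) x = l}. \<forall>j\<le>k. Y j x = y j} =
        prob (?E k y) * jump_matrix Q $ y k $ l"
      by (simp add: step)
  qed
  also have "\<dots> = (\<Sum>y\<in>paths k. \<Sum>i\<in>UNIV. (if y k = i then prob (?E k y) else 0) * jump_matrix Q $ i $ l)"
  proof (rule sum.cong[OF refl])
    fix y
    have "(\<Sum>i\<in>UNIV. (if y k = i then prob (?E k y) else 0) * jump_matrix Q $ i $ l) =
        (\<Sum>i\<in>UNIV. if y k = i then prob (?E k y) * jump_matrix Q $ i $ l else 0)"
      by (rule sum.cong) auto
    then show "prob (?E k y) * jump_matrix Q $ y k $ l =
        (\<Sum>i\<in>UNIV. (if y k = i then prob (?E k y) else 0) * jump_matrix Q $ i $ l)"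
      by simp
  qed
  also have "\<dots> = (\<Sum>i\<in>UNIV. state_prob k i * jump_matrix Q $ i $ l)"
    by (subst sum.swap) (simp add: state_prob_sum_paths sum_distrib_right)
  finally show ?thesis .
qed

lemma prob_state_sojourn:
  assumes B: "B \<in> sets borel"
  shows "prob {x \<in> space Pr. Y k x = l \<and> S k x \<in> B} =
    state_prob k l * measure (exponential_measure (rates Q $ l)) B"
proof -
  let ?E = "\<lambda>y. {x \<in> space Pr. \<forall>j\<le>k. Y j x = y j}"
  have ev: "{x \<in> space Pr. Y k x = l \<and> S k x \<in> B} \<in> events"
  proof -
    have "{x \<in> space Pr. Y k x = l \<and> S k x \<in> B} =
        {x \<in> space Pr. Y k x = l} \<inter> (S k -` B \<inter> space Pr)" by auto
    also have "\<dots> \<in> events" using measurable_sets[OF S_measurable B] by auto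
    finally show ?thesis .
  qed
  have "prob {x \<in> {x \<in> space Pr. Y k x = l \<and> S k x \<in> B}. \<forall>j\<le>k. Y j x = y j} =
      (if y k = l then prob (?E y) else 0) * measure (exponential_measure (rates Q $ l)) B" for y
  proof (cases "y k = l")
    case True
    \<comment> \<open>Only the last sojourn time is constrained; the earlier factors are total
      masses.\<close>
    define B' where "B' j = (if j = k then B else UNIV)" for j
    have one: "measure (exponential_measure (rates Q $ y j)) UNIV = 1" for j
    proof -
      interpret E: prob_space "exponential_measure (rates Q $ y j)"
        unfolding exponential_measure_def by (rule prob_space_exponential_density[OF rates_pos])
      show ?thesis using E.prob_space by (simp add: exponential_measure_def)
    qed
    have "{x \<in> {x \<in> space Pr. Y k x = l \<and> S k x \<in> B}. \<forall>j\<le>k. Y j x = y j} =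
        {x \<in> space Pr. \<forall>j\<le>k. Y j x = y j \<and> S j x \<in> B' j}"
      using True by (auto simp: B'_def)
    also have "prob \<dots> = prob (?E y) * (\<Prod>j\<le>k. measure (exponential_measure (rates Q $ y j)) (B' j))"
      by (rule sojourn_law) (simp add: B'_def B)
    also have "(\<Prod>j\<le>k. measure (exponential_measure (rates Q $ y j)) (B' j)) =
        (\<Prod>j\<le>k. if j = k then measure (exponential_measure (rates Q $ l)) B else 1)"
      by (rule prod.cong) (auto simp: B'_def one True)
    finally show ?thesis using True by simp
  next
    case False
    then have "{x \<in> {x \<in> space Pr. Y k x = l \<and> S k x \<in> B}. \<forall>j\<le>k. Y j x = y j} = {}" by auto
    with False show ?thesis by (simp only: measure_empty if_False mult_zero_left)
  qed
  then show ?thesis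
    unfolding prob_split_paths[OF ev, of k] by (simp add: state_prob_sum_paths sum_distrib_right)
qed

text \<open>The law of \<open>S k\<close> on the event \<open>Y k = l\<close> is the exponential law
  scaled by \<open>state_prob k l\<close>. Weighting \<open>Pr\<close> with the indicator instead of
  conditioning also covers states of probability 0.\<close>

lemma sojourn_moment:
  "has_bochner_integral Pr (\<lambda>x. indicator {x \<in> space Pr. Y k x = l} x * S k x ^ i)
     (state_prob k l * (fact i / (rates Q $ l) ^ i))"
proof -
  let ?A = "{x \<in> space Pr. Y k x = l}" and ?E = "exponential_measure (rates Q $ l)"
  interpret E: prob_space ?E
    unfolding exponential_measure_def by (rule prob_space_exponential_density[OF rates_pos])
  have [simp]: "sets ?E = sets borel" "space ?E = UNIV" by (simp_all add: exponential_measure_def)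
  have [measurable]: "S k \<in> borel_measurable Pr" by (rule S_measurable)
  have sp0: "0 \<le> state_prob k l" by (simp add: state_prob_def)
  have eq: "distr (density Pr (\<lambda>x. ennreal (indicator ?A x))) borel (S k) =
      density ?E (\<lambda>_. ennreal (state_prob k l))"
  proof (rule measure_eqI)
    fix B assume "B \<in> sets (distr (density Pr (\<lambda>x. ennreal (indicator ?A x))) borel (S k))"
    then have B[measurable]: "B \<in> sets borel" by simp
    have "emeasure (distr (density Pr (\<lambda>x. ennreal (indicator ?A x))) borel (S k)) B =
        (\<integral>\<^sup>+x. ennreal (indicator ?A x) * indicator (S k -` B \<inter> space Pr) x \<partial>Pr)"
      by (subst emeasure_distr) (auto simp: emeasure_density)
    also have "\<dots> = (\<integral>\<^sup>+x. indicator {x \<in> space Pr. Y k x = l \<and> S k x \<in> B} x \<partial>Pr)"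
      by (intro nn_integral_cong) (auto simp: indicator_def)
    also have "\<dots> = emeasure Pr {x \<in> space Pr. Y k x = l \<and> S k x \<in> B}"
    proof (rule nn_integral_indicator)
      have "{x \<in> space Pr. Y k x = l \<and> S k x \<in> B} = ?A \<inter> (S k -` B \<inter> space Pr)" by auto
      then show "{x \<in> space Pr. Y k x = l \<and> S k x \<in> B} \<in> events" by simp
    qed
    also have "\<dots> = ennreal (state_prob k l) * emeasure ?E B"
      by (simp add: emeasure_eq_measure prob_state_sojourn E.emeasure_eq_measure ennreal_mult' sp0)
    also have "\<dots> = emeasure (density ?E (\<lambda>_. ennreal (state_prob k l))) B"
      by (subst emeasure_density_const) auto
    finally show "emeasure (distr (density Pr (\<lambda>x. ennreal (indicator ?A x))) borel (S k)) B =
        emeasure (density ?E (\<lambda>_. ennreal (state_prob k l))) B" .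
  qed simp
  have "has_bochner_integral (density ?E (\<lambda>_. ennreal (state_prob k l))) (\<lambda>s. s ^ i)
      (state_prob k l * (fact i / (rates Q $ l) ^ i))"
  proof (rule has_bochner_integral_density)
    show "(\<lambda>s. s ^ i) \<in> borel_measurable ?E"
      by (simp add: exponential_measure_def)
    show "has_bochner_integral ?E (\<lambda>s. state_prob k l *\<^sub>R s ^ i) (state_prob k l * (fact i / (rates Q $ l) ^ i))"
      unfolding real_scaleR_def
      by (rule has_bochner_integral_mult_right[OF exponential_measure_moment[OF rates_pos]])
  qed (simp_all add: sp0)
  then have "integrable (distr (density Pr (\<lambda>x. ennreal (indicator ?A x))) borel (S k)) (\<lambda>s. s ^ i)"
    "integral\<^sup>L (distr (density Pr (\<lambda>x. ennreal (indicator ?A x))) borel (S k)) (\<lambda>s. s ^ i) =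
      state_prob k l * (fact i / (rates Q $ l) ^ i)"
    unfolding eq by (simp_all only: has_bochner_integral_iff)
  then show ?thesis
    by (simp add: has_bochner_integral_iff integrable_distr_eq integral_distr integrable_density integral_density)
qed

text \<open>Exponential laws give no mass to the negative half-line. The sign keeps the off-diagonal
  entries of the exponents nonnegative, as \<open>mat_exp_nonneg\<close> requires.\<close>

lemma AE_sojourn_nonneg: "AE x in Pr. \<forall>k. 0 \<le> S k x"
proof -
  have "AE x in Pr. \<not> (Y k x = l \<and> S k x \<in> {..<0})" for k l
  proof (rule AE_I')
    have "measure (exponential_measure (rates Q $ l)) {..<0} = 0"
    proof -
      have "emeasure (exponential_measure (rates Q $ l)) {..<0} =
          (\<integral>\<^sup>+x. ennreal (exponential_density (rates Q $ l) x) * indicator {..<0} x \<partial>lborel)"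
        unfolding exponential_measure_def by (rule emeasure_density) auto
      also have "\<dots> = (\<integral>\<^sup>+x. 0 \<partial>(lborel :: real measure))"
        by (rule nn_integral_cong) (simp add: exponential_density_def split: split_indicator)
      finally have "emeasure (exponential_measure (rates Q $ l)) {..<0} = 0" by simp
      then show ?thesis by (simp add: measure_def)
    qed
    then have "prob {x \<in> space Pr. Y k x = l \<and> S k x \<in> {..<0}} = 0"
      by (subst prob_state_sojourn) auto
    moreover have "{x \<in> space Pr. Y k x = l \<and> S k x \<in> {..<0}} \<in> events"
    proof -
      have "{x \<in> space Pr. Y k x = l \<and> S k x \<in> {..<0}} =
          {x \<in> space Pr. Y k x = l} \<inter> (S k -` {..<0} \<inter> space Pr)" by auto
      also have "\<dots> \<in> events" using measurable_sets[OF S_measurable, of "{..<0}"] by auto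
      finally show ?thesis .
    qed
    ultimately show "{x \<in> space Pr. Y k x = l \<and> S k x \<in> {..<0}} \<in> null_sets Pr"
      by (simp add: null_sets_def emeasure_eq_measure)
  qed auto
  then have "AE x in Pr. \<forall>k l. \<not> (Y k x = l \<and> S k x \<in> {..<0})"
    unfolding AE_all_countable by blast
  then show ?thesis by eventually_elim (auto simp: not_less)
qed

section \<open>Averages of the drift and their expectations\<close>

lemma drift_step_eq:
  assumes "x \<in> space Pr"
  shows "(f (Y k x) * S k x) ^ i = (\<Sum>l\<in>UNIV. f l ^ i * (indicator {x \<in> space Pr. Y k x = l} x * S k x ^ i))"
proof -
  have "(\<Sum>l\<in>UNIV. f l ^ i * (indicator {x \<in> space Pr. Y k x = l} x * S k x ^ i)) =
      (\<Sum>l\<in>UNIV. if l = Y k x then f l ^ i * S k x ^ i else 0)"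
    by (rule sum.cong) (use assms in \<open>auto simp: indicator_def\<close>)
  then show ?thesis by (simp add: power_mult_distrib)
qed

lemma drift_step_moment:
  "has_bochner_integral Pr (\<lambda>x. (f (Y k x) * S k x) ^ i)
     (\<Sum>l\<in>UNIV. f l ^ i * (state_prob k l * (fact i / (rates Q $ l) ^ i)))"
  by (subst has_bochner_integral_cong[OF refl drift_step_eq refl], assumption)
    (intro has_bochner_integral_sum has_bochner_integral_mult_right sojourn_moment)

lemma state_prob_le_1: "0 \<le> state_prob k l" "state_prob k l \<le> 1"
  by (simp_all add: state_prob_def)

text \<open>The Poisson equation turns the mean of \<open>f\<close> at time \<open>k\<close> into
  \<open>p \<bullet> f\<close> plus a telescoping difference, so the averages are off by a bounded
  quantity over \<open>n\<close>. Averaging makes this valid for periodic chains such as the cyclic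
  one.\<close>

lemma expected_drift_tendsto:
  assumes p: "stationary_distribution (jump_matrix Q) p"
  shows "(\<lambda>n. (\<Sum>k<n. \<Sum>l\<in>UNIV. f $ l * state_prob k l) / real n) \<longlonglongrightarrow> p \<bullet> f"
proof -
  obtain g where g: "f - (\<chi> i. p \<bullet> f) = g - jump_matrix Q *v g"
    using poisson_equation[OF p] by blast
  define G where "G k = (\<Sum>l\<in>UNIV. g $ l * state_prob k l)" for k
  have total: "(\<Sum>l\<in>UNIV. state_prob k l) = 1" for k
  proof -
    have "(\<Sum>l\<in>UNIV. state_prob k l) = prob (\<Union>l\<in>UNIV. {x \<in> space Pr. Y k x = l})"
      unfolding state_prob_def
      by (rule finite_measure_finite_Union[symmetric]) (auto simp: disjoint_family_on_def)
    also have "(\<Union>l\<in>UNIV. {x \<in> space Pr. Y k x = l}) = space Pr" by auto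
    finally show ?thesis by (simp add: prob_space)
  qed
  have step: "(\<Sum>l\<in>UNIV. f $ l * state_prob k l) = p \<bullet> f + (G k - G (Suc k))" for k
  proof -
    have "f $ l = p \<bullet> f + g $ l - (jump_matrix Q *v g) $ l" for l
      using arg_cong[OF g, of "\<lambda>z. z $ l"] by simp
    then have "(\<Sum>l\<in>UNIV. f $ l * state_prob k l) =
        (p \<bullet> f) * (\<Sum>l\<in>UNIV. state_prob k l) + G k - (\<Sum>l\<in>UNIV. (jump_matrix Q *v g) $ l * state_prob k l)"
      unfolding G_def sum_distrib_left sum.distrib[symmetric] sum_subtractf[symmetric]
      by (simp only: left_diff_distrib distrib_right)
    also have "(\<Sum>l\<in>UNIV. (jump_matrix Q *v g) $ l * state_prob k l) = G (Suc k)"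
      unfolding G_def state_prob_Suc matrix_vector_mult_def vec_lambda_beta sum_distrib_left sum_distrib_right
      by (subst sum.swap) (simp add: mult_ac)
    finally show ?thesis by (simp add: total)
  qed
  have G: "\<bar>G k\<bar> \<le> (\<Sum>l\<in>UNIV. \<bar>g $ l\<bar>)" for k
    unfolding G_def
    by (intro order.trans[OF sum_abs] sum_mono)
      (simp add: abs_mult state_prob_le_1 mult_left_le)
  have sum: "(\<Sum>k<n. \<Sum>l\<in>UNIV. f $ l * state_prob k l) = real n * (p \<bullet> f) + (G 0 - G n)" for n
    by (simp add: step sum.distrib sum_lessThan_telescope')
  have "(\<lambda>n. (\<Sum>k<n. \<Sum>l\<in>UNIV. f $ l * state_prob k l) / real n - p \<bullet> f) \<longlonglongrightarrow> 0"
  proof (rule Lim_null_comparison)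
    show "(\<lambda>n. (2 * (\<Sum>l\<in>UNIV. \<bar>g $ l\<bar>)) / real n) \<longlonglongrightarrow> 0" by (rule lim_const_over_n)
    have "norm ((\<Sum>k<n. \<Sum>l\<in>UNIV. f $ l * state_prob k l) / real n - p \<bullet> f)
        \<le> (2 * (\<Sum>l\<in>UNIV. \<bar>g $ l\<bar>)) / real n" if "0 < n" for n
    proof -
      have "(\<Sum>k<n. \<Sum>l\<in>UNIV. f $ l * state_prob k l) / real n - p \<bullet> f = (G 0 - G n) / real n"
        using that by (simp add: sum add_divide_distrib)
      moreover have "\<bar>G 0 - G n\<bar> \<le> 2 * (\<Sum>l\<in>UNIV. \<bar>g $ l\<bar>)"
        using G[of 0] G[of n] by linarith
      ultimately show ?thesis by (simp add: divide_right_mono)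
    qed
    then show "\<forall>\<^sub>F n in sequentially. norm ((\<Sum>k<n. \<Sum>l\<in>UNIV. f $ l * state_prob k l) / real n - p \<bullet> f)
        \<le> (2 * (\<Sum>l\<in>UNIV. \<bar>g $ l\<bar>)) / real n"
      by (intro eventually_mono[OF eventually_gt_at_top[of 0]])
  qed
  then show ?thesis by (rule LIM_zero_cancel)
qed

text \<open>The almost sure limit is also the limit of the expectations, which are averages of
  \<open>lam $ l / rates Q $ l\<close> under the state probabilities.\<close>

lemma drift_rate_eq_mean_drift:
  fixes lam :: "real^'m"
  assumes p: "stationary_distribution (jump_matrix Q) p"
    and lim: "AE x in Pr. (\<lambda>n. (\<Sum>k<n. lam $ Y k x * S k x) / real n) \<longlonglongrightarrow> w"
  shows "w = mean_drift Q p lam"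
proof -
  define Z where "Z k x = lam $ Y k x * S k x" for k x
  define A where "A n x = (\<Sum>k<n. Z k x) / real n" for n x
  define K where "K = (\<Sum>l\<in>UNIV. (lam $ l)\<^sup>2 * (2 / (rates Q $ l)\<^sup>2))"
  have Z1: "has_bochner_integral Pr (Z k) (\<Sum>l\<in>UNIV. lam $ l / rates Q $ l * state_prob k l)" for k
    using drift_step_moment[of "\<lambda>l. lam $ l" k 1] by (simp add: Z_def[abs_def] mult_ac)
  have Z2: "has_bochner_integral Pr (\<lambda>x. (Z k x)\<^sup>2)
      (\<Sum>l\<in>UNIV. (lam $ l)\<^sup>2 * (state_prob k l * (2 / (rates Q $ l)\<^sup>2)))" for k
    using drift_step_moment[of "\<lambda>l. lam $ l" k 2] by (simp add: Z_def)
  have Z[measurable]: "Z k \<in> borel_measurable Pr" for k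
    using Z1[of k] by (auto simp: has_bochner_integral_iff)
  have A[measurable]: "A n \<in> borel_measurable Pr" for n unfolding A_def by simp
  have EZ2: "expectation (\<lambda>x. (Z k x)\<^sup>2) \<le> K" for k
  proof -
    have "expectation (\<lambda>x. (Z k x)\<^sup>2) = (\<Sum>l\<in>UNIV. (lam $ l)\<^sup>2 * (state_prob k l * (2 / (rates Q $ l)\<^sup>2)))"
      using Z2 by (simp add: has_bochner_integral_iff)
    also have "\<dots> \<le> K"
      unfolding K_def by (intro sum_mono mult_left_mono mult_left_le_one_le) (auto simp: state_prob_le_1)
    finally show ?thesis .
  qed
  \<comment> \<open>Cauchy-Schwarz: the square of an average is at most the average of the squares.
    For \<open>n = 0\<close> both sides are 0, division by zero being 0.\<close>
  have Asq: "(A n x)\<^sup>2 \<le> (\<Sum>k<n. (Z k x)\<^sup>2) / real n" for n x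
  proof (cases "n = 0")
    case False
    have "(A n x)\<^sup>2 \<le> (\<Sum>k<n. (Z k x)\<^sup>2) * real n / (real n)\<^sup>2"
      unfolding A_def power_divide
      using sum_squared_le_sum_of_squares[of "\<lambda>k. Z k x" "{..<n}"]
      by (intro divide_right_mono) simp_all
    also have "\<dots> = (\<Sum>k<n. (Z k x)\<^sup>2) / real n"
      using False by (simp add: power2_eq_square[of "real n"])
    finally show ?thesis .
  qed (simp add: A_def)
  have intS: "integrable Pr (\<lambda>x. (\<Sum>k<n. (Z k x)\<^sup>2) / real n)" for n
    using Z2 by (auto simp: has_bochner_integral_iff)
  have intA: "integrable Pr (\<lambda>x. (A n x)\<^sup>2)" for n
    by (rule Bochner_Integration.integrable_bound[OF intS[of n]]) (use Asq in \<open>auto simp: sum_nonneg\<close>)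
  have K0: "0 \<le> K" by (simp add: K_def sum_nonneg)
  have "(\<lambda>n. expectation (A n)) \<longlonglongrightarrow> w"
  proof (rule expectation_tendsto_const[OF A intA])
    show "expectation (\<lambda>x. (A n x)\<^sup>2) \<le> K" for n
    proof -
      have "expectation (\<lambda>x. (A n x)\<^sup>2) \<le> expectation (\<lambda>x. (\<Sum>k<n. (Z k x)\<^sup>2) / real n)"
        by (rule integral_mono[OF intA intS Asq])
      also have "\<dots> = (\<Sum>k<n. expectation (\<lambda>x. (Z k x)\<^sup>2)) / real n"
        using Z2 by (simp add: has_bochner_integral_iff)
      also have "\<dots> \<le> (\<Sum>k<n. K) / real n"
        by (intro divide_right_mono sum_mono EZ2) simp
      also have "\<dots> \<le> K" using K0 by (cases "n = 0") auto
      finally show ?thesis .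
    qed
    show "AE x in Pr. (\<lambda>n. A n x) \<longlonglongrightarrow> w" using lim by (simp add: A_def Z_def)
  qed
  moreover have "expectation (A n) =
      (\<Sum>k<n. \<Sum>l\<in>UNIV. (\<chi> l. lam $ l / rates Q $ l) $ l * state_prob k l) / real n" for n
    using Z1 by (simp add: A_def[abs_def] has_bochner_integral_iff)
  ultimately have "(\<lambda>n. (\<Sum>k<n. \<Sum>l\<in>UNIV. (\<chi> l. lam $ l / rates Q $ l) $ l * state_prob k l) / real n) \<longlonglongrightarrow> w"
    by simp
  from LIMSEQ_unique[OF this expected_drift_tendsto[OF p]]
  show ?thesis by (simp add: mean_drift_eq)
qed

text \<open>Path by path, \<open>v\<close> is an eigenvector of every factor, with eigenvalue the
  exponential of the drift increment, so \<open>mat_prod_growth\<close> converts the assumed growth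
  into convergence of the drift averages.\<close>

lemma growth_rate_eq_mean_drift:
  fixes \<Omega> :: "'m \<Rightarrow> real^'r^'r"
  assumes p: "stationary_distribution (jump_matrix Q) p"
    and nonneg: "\<And>l i j. i \<noteq> j \<Longrightarrow> 0 \<le> \<Omega> l $ i $ j"
    and v: "\<And>i. 0 < v $ i" "\<And>l. \<Omega> l *v v = lam $ l *\<^sub>R v"
    and growth: "is_growth_rate Pr X \<Omega> w"
  shows "w = mean_drift Q p lam"
proof (rule drift_rate_eq_mean_drift[OF p])
  have "AE x in Pr. \<forall>i j. (\<lambda>n. 1 / real n *
      ln (mat_prod (\<lambda>k. mat_exp (S k x *\<^sub>R \<Omega> (Y k x))) n $ i $ j)) \<longlonglongrightarrow> w"
    using growth by (simp add: is_growth_rate_def Y_def S_def)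
  with AE_sojourn_nonneg show "AE x in Pr. (\<lambda>n. (\<Sum>k<n. lam $ Y k x * S k x) / real n) \<longlonglongrightarrow> w"
  proof eventually_elim
    case (elim x)
    show ?case
    proof (rule mat_prod_growth[where x = v])
      show "0 \<le> mat_exp (S k x *\<^sub>R \<Omega> (Y k x)) $ i $ j" for k i j
        using elim nonneg by (intro mat_exp_nonneg) simp
      show "mat_exp (S k x *\<^sub>R \<Omega> (Y k x)) *v v = exp (lam $ Y k x * S k x) *\<^sub>R v" for k
        by (rule mat_exp_eigenvector) (simp add: scaleR_matrix_vector_assoc[symmetric] v mult.commute)
      show "\<And>i j. (\<lambda>n. 1 / real n * ln (mat_prod (\<lambda>k. mat_exp (S k x *\<^sub>R \<Omega> (Y k x))) n $ i $ j)) \<longlonglongrightarrow> w"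
        using elim by blast
    qed (rule v)
  qed
qed

end

theorem lemma6p2:
  fixes Pr :: "'a measure"
    and X :: "real \<Rightarrow> 'a \<Rightarrow> 'm::finite"
    and Q :: "real^'m^'m"
    and st :: "nat \<Rightarrow> 'm"
    and \<Omega> :: "'m \<Rightarrow> real^'r^'r"
    and pihat lam :: "real^'m"
    and u v :: "'m \<Rightarrow> real^'r"
    and p1 p1' :: "real^('m \<times> 'r)"
    and \<omega> :: real
  assumes environment: "irreducible_ctmc Pr X Q"
    and states: "bij_betw st {1..CARD('m)} UNIV"
    and pihat: "stationary_distribution (jump_matrix Q) pihat"
    and Omega_nonneg: "\<And>l i j. i \<noteq> j \<Longrightarrow> 0 \<le> \<Omega> l $ i $ j"
    and Omega_irreducible: "\<And>l. irreducible_matrix (\<Omega> l)"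
    and lam: "\<And>l. dominant_eigenvalue (\<Omega> l) (lam $ l)"
    and u_pos: "\<And>l i. 0 < u l $ i" and u_eigen: "\<And>l. u l v* \<Omega> l = lam $ l *\<^sub>R u l"
    and v_pos: "\<And>l i. 0 < v l $ i" and v_eigen: "\<And>l. \<Omega> l *v v l = lam $ l *\<^sub>R v l"
    and u_normalised: "\<And>l. (\<Sum>i\<in>UNIV. u l $ i) = 1"
    and uv_normalised: "\<And>l. u l \<bullet> v l = 1"
    and p1: "stationary_distribution
               (block_diag (N_block Q \<Omega> lam v) ** (jump_matrix Q \<otimes>\<^sub>K mat 1)) p1"
    and p1': "stationary_distribution
               (block_diag (N'_block Q \<Omega> lam u) ** (reversed_jump_matrix Q pihat \<otimes>\<^sub>K mat 1)) p1'"
    and growth: "is_growth_rate Pr X \<Omega> \<omega>"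
    and commute: "\<And>l l'. \<Omega> l ** \<Omega> l' = \<Omega> l' ** \<Omega> l"
  shows "omega_L Q \<Omega> pihat lam v p1 = omega_L' Q \<Omega> pihat lam u p1' \<and>
         omega_L' Q \<Omega> pihat lam u p1' = omega_U Q \<Omega> pihat lam \<and>
         omega_U Q \<Omega> pihat lam = \<omega> \<and>
         \<omega> = pihat \<bullet> (matrix_inv (rate_matrix Q) *v lam) \<and>
         (\<forall>\<alpha>. (AE x in Pr. \<forall>k. jump_chain (\<lambda>t. X t x) k = st (k mod CARD('m) + 1)) \<longrightarrow>
               \<alpha> v* N_prod st Q \<Omega> lam v = \<alpha> \<longrightarrow> (\<Sum>i\<in>UNIV. \<alpha> $ i) = 1 \<longrightarrow>
               omega_L_star st Q \<Omega> pihat lam v \<alpha> = \<omega>)"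
proof -
  interpret irreducible_ctmc Pr X Q "\<lambda>k x. jump_chain (\<lambda>t. X t x) k" "\<lambda>k x. sojourn (\<lambda>t. X t x) k"
    by (rule environment) simp_all
  note common = common_Perron_eigenvectors[of \<Omega> u "\<lambda>l. lam $ l" v, OF Omega_nonneg Omega_irreducible
      u_pos u_eigen v_pos v_eigen u_normalised uv_normalised commute]
  \<comment> \<open>By \<open>common\<close> every state gives the same vectors, so an arbitrary
    state represents them.\<close>
  define x where "x = v undefined"
  define y where "y = u undefined"
  have v: "v = (\<lambda>_. x)" and u: "u = (\<lambda>_. y)"
    using common by (auto simp: x_def y_def)
  have x: "0 < x $ i" "\<Omega> l *v x = lam $ l *\<^sub>R x" for l i
    using v_pos v_eigen by (simp_all add: v)
  \<comment> \<open>The logarithm of a constant stack is again a constant stack, hence fixed by the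
    environment factors of both stationary chains.\<close>
  have ln_vec_stack: "ln_vec (stack (\<lambda>_::'m. z)) = stack (\<lambda>_. ln_vec z)" for z :: "real^'r"
    by (simp add: ln_vec_def stack_def vec_eq_iff)
  have "\<omega> = mean_drift Q pihat lam"
    by (rule growth_rate_eq_mean_drift[OF pihat Omega_nonneg x growth])
  moreover have "omega_L Q \<Omega> pihat lam v p1 = mean_drift Q pihat lam"
    using stationary_distribution_correction_zero[OF p1 kronecker_mult_stack_const[OF jump_matrix_row_sum]]
    by (simp add: omega_L_def v ln_vec_stack)
  moreover have "omega_L' Q \<Omega> pihat lam u p1' = mean_drift Q pihat lam"
    using stationary_distribution_correction_zero[OF p1'
        kronecker_mult_stack_const[OF reversed_jump_matrix_row_sum[OF pihat]]]
    by (simp add: omega_L'_def u ln_vec_stack)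
  moreover have "omega_U Q \<Omega> pihat lam = mean_drift Q pihat lam"
  proof -
    have "0 \<le> M_block Q \<Omega> lam l $ i $ j" "M_block Q \<Omega> lam l *v x = x" for l i j
      using M_block_Perron[of \<Omega> l x lam Q, OF Omega_nonneg x rates_pos] by auto
    from spectral_radius_upper_bound[OF jump_matrix_nonneg jump_matrix_row_sum this x(1)]
    show ?thesis by (simp add: omega_U_def)
  qed
  moreover have "omega_L_star st Q \<Omega> pihat lam v \<alpha> = mean_drift Q pihat lam" for \<alpha>
    unfolding v by (rule omega_L_star_const[OF x(1)])
  ultimately show ?thesis by (simp add: mean_drift_def)
qed

end
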